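(* Let $k\ge 1$ be an integer, and for $1\le i\le k$ let $d_i>0$ and $q_i\in\mathbb{R}$. Let $(\mathsf{F}(t))_{t\ge 0}$ be a real-valued Gaussian process with mean function $F(t)=\mathbb{E}[\mathsf{F}(t)]$ and covariance function $K(t,t')=\operatorname{Cov}(\mathsf{F}(t),\mathsf{F}(t'))$. For $1\le i\le k$ let $(\mathsf{S}_i(t))_{t\ge 0}$ be the stochastic process solving $$\mathrm{d}\mathsf{S}_i(t)=\frac{1}{d_i}\bigl(q_i\,\mathsf{F}(t)-\mathsf{S}_i(t)\bigr)\,\mathrm{d}t,\qquad \mathsf{S}_i(0)=0,$$ and let $\mathsf{T}(t)=\sum_{i=1}^k \mathsf{S}_i(t)$. Then: (1) For every $i$ and $t\ge 0$, $\displaystyle \mathsf{S}_i(t)=\frac{q_i}{d_i}\int_0^t \mathsf{F}(s)\,e^{-(t-s)/d_i}\,\mathrm{d}s$. (2) For every $i$, $\mathsf{S}_i$ is a Gaussian process with mean function $$m_i(t)=\frac{q_i}{d_i}\int_0^t F(s)\,e^{-(t-s)/d_i}\,\mathrm{d}s,$$ and for all $i,j\in\{1,\dots,k\}$ and $t,t'\ge 0$, $$\operatorname{Cov}(\mathsf{S}_i(t),\mathsf{S}_j(t'))=k_{ij}(t,t'):=\frac{q_iq_j}{d_id_j}\int_0^t\int_0^{t'}K(s,s')\,e^{-(t-s)/d_i}\,e^{-(t'-s')/d_j}\,\mathrm{d}s'\,\mathrm{d}s;$$ in particular $\mathsf{S}_i$ has covariance function $k_{ii}$. (3) $\mathsf{T}$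 is a Gaussian process with mean function $m_{\mathsf{T}}(t)=\sum_{i=1}^k m_i(t)$ and covariance function $k_{\mathsf{T}}(t,t')=\sum_{i=1}^k\sum_{j=1}^k k_{ij}(t,t')$.
   Context: A real-valued stochastic process $(f(t))_{t\ge 0}$ is a Gaussian process with mean function $m$ and covariance function $c$ if every finite collection of evaluations $(f(t_1),\dots,f(t_n))$ has a joint multivariate normal distribution (possibly degenerate) with mean vector $(m(t_a))_a$ and covariance matrix $(c(t_a,t_b))_{a,b}$. In the application, $\mathsf{F}$ is the radiative forcing, $\mathsf{S}_i$ the $i$-th thermal response (with response timescale $d_i$ and equilibrium response $q_i$) and $\mathsf{T}$ the global mean surface temperature. The statement is for a generic Gaussian process $\mathsf{F}$; no regularity condition is imposed on $\mathsf{F}$, $F$ or $K$, and the integrals are written as in the source, where their existence is left implicit.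
   Formalization: The Gaussian process F is additionally assumed jointly measurable in time and outcome; without this, F can vanish almost surely at each t while every path integrates to t, so the mean formula in (2) fails. *)

theory Defs
  imports "HOL-Probability.Probability"
begin

definition covariance :: "'w measure \<Rightarrow> ('w \<Rightarrow> real) \<Rightarrow> ('w \<Rightarrow> real) \<Rightarrow> real" where
  "covariance M X Y =
     (\<integral>w. (X w - (\<integral>v. X v \<partial>M)) * (Y w - (\<integral>v. Y v \<partial>M)) \<partial>M)"

(* The second disjunct is the degenerate case of variance zero. *)
definition normal_rv :: "'w measure \<Rightarrow> ('w \<Rightarrow> real) \<Rightarrow> bool" where
  "normal_rv M X \<longleftrightarrow> X \<in> borel_measurable M \<and>
     (\<exists>\<mu> \<sigma>. (0 < \<sigma> \<and> distributed M lborel X (normal_density \<mu> \<sigma>)) \<or> (AE w in M. X w = \<mu>))"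

(* The random vector (X 0, ..., X (n-1)) is jointly normal, possibly degenerate: every linear
   combination of its coordinates is normal. Taking unit vectors for c, each coordinate is then
   a square-integrable random variable, so the Bochner integrals for mean and covariance exist. *)
definition multivariate_normal ::
  "'w measure \<Rightarrow> nat \<Rightarrow> (nat \<Rightarrow> 'w \<Rightarrow> real) \<Rightarrow> (nat \<Rightarrow> real) \<Rightarrow> (nat \<Rightarrow> nat \<Rightarrow> real) \<Rightarrow> bool"
where
  "multivariate_normal M n X \<mu> \<Sigma> \<longleftrightarrow>
     (\<forall>c. normal_rv M (\<lambda>w. \<Sum>a<n. c a * X a w)) \<and>
     (\<forall>a<n. (\<integral>w. X a w \<partial>M) = \<mu> a) \<and>
     (\<forall>a<n. \<forall>b<n. covariance M (X a) (X b) = \<Sigma> a b)"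

definition gaussian_process ::
  "'w measure \<Rightarrow> (real \<Rightarrow> 'w \<Rightarrow> real) \<Rightarrow> (real \<Rightarrow> real) \<Rightarrow> (real \<Rightarrow> real \<Rightarrow> real) \<Rightarrow> bool"
where
  "gaussian_process M X m c \<longleftrightarrow>
     (\<forall>n (t :: nat \<Rightarrow> real). (\<forall>a<n. 0 \<le> t a) \<longrightarrow>
        multivariate_normal M n (\<lambda>a. X (t a)) (\<lambda>a. m (t a)) (\<lambda>a b. c (t a) (t b)))"

(* A path x solves dx(t) = (1/d) (q f(t) - x(t)) dt, x(0) = 0, on [0, \<infinity>). As usual for stochastic
   differential equations, the differential notation stands for the integral equation, whose
   integrals have to exist. No continuity of f is needed. *)
definition solves_response :: "real \<Rightarrow> real \<Rightarrow> (real \<Rightarrow> real) \<Rightarrow> (real \<Rightarrow> real) \<Rightarrow> bool" where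
  "solves_response d q f x \<longleftrightarrow> x 0 = 0 \<and>
     (\<forall>t\<ge>0. set_integrable lborel {0..t} (\<lambda>s. 1 / d * (q * f s - x s)) \<and>
            x t = x 0 + (LBINT s:{0..t}. 1 / d * (q * f s - x s)))"

definition response_mean :: "real \<Rightarrow> real \<Rightarrow> (real \<Rightarrow> real) \<Rightarrow> real \<Rightarrow> real" where
  "response_mean d q m t = q / d * (LBINT s:{0..t}. m s * exp (- (t - s) / d))"

definition response_cov ::
  "real \<Rightarrow> real \<Rightarrow> real \<Rightarrow> real \<Rightarrow> (real \<Rightarrow> real \<Rightarrow> real) \<Rightarrow> real \<Rightarrow> real \<Rightarrow> real"
where
  "response_cov d q d' q' K t t' = (q * q') / (d * d') *
     (LBINT s:{0..t}. LBINT s':{0..t'}. K s s' * exp (- (t - s) / d) * exp (- (t' - s') / d'))"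

end

(* The variation-of-constants formula holds path by path, by Fubini. The responses are therefore
   integrals of F against bounded kernels, and it remains to integrate under the expectation and to
   see that such integrals are normal.

   Only almost sure integrability of the paths is known. For Gaussian F it implies that the
   function s |-> ||F(s)|| (norm in L^2 of the probability space) is integrable: removing an event of
   small probability decreases the first moment of a normal variable at most by a universal factor,
   and this first moment is comparable to the L^2 norm; off such an event the integral of |F| is
   bounded. This justifies every use of Fubini.

   Normality: after a change of measure with density proportional to 1 + ||F(s)||, the integral is an
   average of L^2-bounded variables over a probability measure. By Maurey's empirical method it is
   the L^2 limit of averages of n samples, which are finite linear combinations of values of F, and
   L^2 limits of normal variables are normal by Levy's uniqueness theorem. *)
theory Submission
  imports Defs
begin

section \<open>Normal random variables\<close>

text \<open>Riemann sums cannot give the normality of the integrals, since no continuity of the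
  paths, of \<open>mF\<close> or of \<open>K\<close> is assumed; random sampling of the times gets
  by with joint measurability. Sampling needs a uniform L^2 bound, and the change of measure
  supplies it: \<open>X s\<close> divided by 1 plus its norm has norm at most 1. The summand 1 keeps
  the density positive, so that it can be divided by even where the norm vanishes. Joint normality
  is a statement about linear combinations. Exponential kernels cut off at their own times are
  bounded weights on one common interval, and a combination of such integrals is the integral of the
  combined weight. So the normality of a single integral is enough. The response equation controls
  only \<open>q i * F\<close>. If every \<open>q i\<close> vanishes it says nothing about the paths
  of \<open>F\<close>, which is why that case is separate.\<close>

lemma integrable_mult_of_squares:
  fixes f g :: "'a \<Rightarrow> real"
  assumes [measurable]: "f \<in> borel_measurable M" "g \<in> borel_measurable M"
    and "integrable M (\<lambda>x. (f x)\<^sup>2)" "integrable M (\<lambda>x. (g x)\<^sup>2)"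
  shows "integrable M (\<lambda>x. f x * g x)"
proof (rule Bochner_Integration.integrable_bound)
  show "integrable M (\<lambda>x. (f x)\<^sup>2 + (g x)\<^sup>2)"
    using assms by auto
  have "\<bar>f x * g x\<bar> \<le> (f x)\<^sup>2 + (g x)\<^sup>2" for x
  proof -
    have "0 \<le> (\<bar>f x\<bar> - \<bar>g x\<bar>)\<^sup>2" "0 \<le> \<bar>f x\<bar> * \<bar>g x\<bar>"
      by simp_all
    then show ?thesis
      unfolding power2_diff abs_mult power2_abs by linarith
  qed
  then show "AE x in M. norm (f x * g x) \<le> norm ((f x)\<^sup>2 + (g x)\<^sup>2)"
    by auto
qed auto

text \<open>Cauchy-Schwarz: the integral of the square of b |f| - a |g| is nonnegative, where
  \<open>a\<close> and \<open>b\<close> are the two L^2 norms, and a b can be divided out. If one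
  norm is 0, the product vanishes almost everywhere.\<close>

lemma integral_abs_mult_le:
  fixes f g :: "'a \<Rightarrow> real"
  assumes [measurable]: "f \<in> borel_measurable M" "g \<in> borel_measurable M"
    and f: "integrable M (\<lambda>x. (f x)\<^sup>2)" and g: "integrable M (\<lambda>x. (g x)\<^sup>2)"
  shows "(\<integral>x. \<bar>f x * g x\<bar> \<partial>M) \<le> sqrt (\<integral>x. (f x)\<^sup>2 \<partial>M) * sqrt (\<integral>x. (g x)\<^sup>2 \<partial>M)"
proof -
  define a where "a = sqrt (\<integral>x. (f x)\<^sup>2 \<partial>M)"
  define b where "b = sqrt (\<integral>x. (g x)\<^sup>2 \<partial>M)"
  have a2: "a\<^sup>2 = (\<integral>x. (f x)\<^sup>2 \<partial>M)" and b2: "b\<^sup>2 = (\<integral>x. (g x)\<^sup>2 \<partial>M)"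
    and nn: "0 \<le> a" "0 \<le> b"
    by (simp_all add: a_def b_def)
  have fg: "integrable M (\<lambda>x. \<bar>f x * g x\<bar>)"
    using integrable_mult_of_squares[OF assms] by simp
  show ?thesis
  proof (cases "a = 0 \<or> b = 0")
    case True
    then have "(AE x in M. (f x)\<^sup>2 = 0) \<or> (AE x in M. (g x)\<^sup>2 = 0)"
      using integral_nonneg_eq_0_iff_AE[OF f] integral_nonneg_eq_0_iff_AE[OF g] a2 b2 by auto
    then have "AE x in M. \<bar>f x * g x\<bar> = 0"
      by auto
    then have "(\<integral>x. \<bar>f x * g x\<bar> \<partial>M) = 0"
      using integral_nonneg_eq_0_iff_AE[OF fg] by auto
    then show ?thesis
      using nn by (simp add: a_def b_def)
  next
    case False
    have "0 \<le> (\<integral>x. (b * \<bar>f x\<bar> - a * \<bar>g x\<bar>)\<^sup>2 \<partial>M)"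
      by simp
    also have "\<dots> = (\<integral>x. b\<^sup>2 * (f x)\<^sup>2 + a\<^sup>2 * (g x)\<^sup>2 - 2 * a * b * \<bar>f x * g x\<bar> \<partial>M)"
      by (intro Bochner_Integration.integral_cong) (auto simp: power2_diff power_mult_distrib abs_mult)
    also have "\<dots> = 2 * a\<^sup>2 * b\<^sup>2 - 2 * a * b * (\<integral>x. \<bar>f x * g x\<bar> \<partial>M)"
      using f g fg by (simp add: a2 b2)
    finally have "a * b * (\<integral>x. \<bar>f x * g x\<bar> \<partial>M) \<le> a * b * (a * b)"
      by (simp add: power2_eq_square algebra_simps)
    then show ?thesis
      using False nn by (auto simp: a_def[symmetric] b_def[symmetric])
  qed
qed

lemma (in prob_space) expectation_abs_le:
  assumes [measurable]: "random_variable borel (X :: 'a \<Rightarrow> real)" and "integrable M (\<lambda>x. (X x)\<^sup>2)"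
  shows "expectation (\<lambda>x. \<bar>X x\<bar>) \<le> sqrt (expectation (\<lambda>x. (X x)\<^sup>2))"
  using integral_abs_mult_le[of X M "\<lambda>_. 1"] assms by (simp add: prob_space)

lemma std_normal_integrals:
  "integrable std_normal_distribution (\<lambda>z. z)" "(\<integral>z. z \<partial>std_normal_distribution) = 0"
  "integrable std_normal_distribution (\<lambda>z. z\<^sup>2)" "(\<integral>z. z\<^sup>2 \<partial>std_normal_distribution) = 1"
  "(\<integral>z. \<bar>z\<bar> \<partial>std_normal_distribution) = sqrt (2 / pi)"
  using integrable_std_normal_moment[of 1] integral_std_normal_moment_odd[of 0]
    integrable_std_normal_moment[of 2] integral_std_normal_moment_even[of 1]
    integral_std_normal_moment_abs_odd[of 0]
  by (simp_all add: integrable_density integral_density)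

lemma char_affine_std_normal:
  "char (distr std_normal_distribution borel (\<lambda>z. \<mu> + \<sigma> * z)) t =
     iexp (t * \<mu>) * of_real (exp (- (t\<^sup>2 * \<sigma>\<^sup>2) / 2))"
proof -
  have "char (distr std_normal_distribution borel (\<lambda>z. \<mu> + \<sigma> * z)) t =
      (CLINT z|std_normal_distribution. iexp (t * \<mu>) * iexp ((t * \<sigma>) * z))"
    unfolding char_def
    by (subst integral_distr) (auto simp: algebra_simps simp flip: exp_add)
  also have "\<dots> = iexp (t * \<mu>) * char std_normal_distribution (t * \<sigma>)"
    by (simp add: char_def)
  finally show ?thesis
    by (simp add: char_std_normal_distribution power_mult_distrib)
qed

lemma distr_lborel: "distr M lborel f = distr M borel f"
  by (rule distr_cong) auto

text \<open>Degenerate and nondegenerate laws become one family, the affine images of the standard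
  normal law with slope \<sigma> possibly 0, so that later arguments need no case
  distinction.\<close>

lemma normal_rv_iff_distr:
  assumes "prob_space M"
  shows "normal_rv M X \<longleftrightarrow> X \<in> borel_measurable M \<and>
    (\<exists>\<mu> \<sigma>. 0 \<le> \<sigma> \<and> distr M borel X = distr std_normal_distribution borel (\<lambda>z. \<mu> + \<sigma> * z))"
proof -
  interpret prob_space M by fact
  interpret std: prob_space std_normal_distribution
    by (rule prob_space_normal_density) simp
  have pos: "distributed M lborel X (normal_density \<mu> \<sigma>) \<longleftrightarrow>
      distr M borel X = distr std_normal_distribution borel (\<lambda>z. \<mu> + \<sigma> * z)"
    if "0 < \<sigma>" "X \<in> borel_measurable M" for \<mu> \<sigma>
  proof -
    have "distributed std_normal_distribution lborel (\<lambda>z. z) std_normal_density"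
      by (auto simp: distributed_def intro!: distr_id2)
    then have "distributed std_normal_distribution lborel (\<lambda>z. \<mu> + \<sigma> * z) (normal_density \<mu> \<sigma>)"
      using std.normal_density_affine[of "\<lambda>z. z" 0 1 \<sigma> \<mu>] that by simp
    then have "distr std_normal_distribution lborel (\<lambda>z. \<mu> + \<sigma> * z) = density lborel (normal_density \<mu> \<sigma>)"
      by (simp add: distributed_def)
    then show ?thesis
      using that by (auto simp: distributed_def distr_lborel)
  qed
  have zero: "(AE w in M. X w = \<mu>) \<longleftrightarrow>
      distr M borel X = distr std_normal_distribution borel (\<lambda>z. \<mu> + 0 * z)"
    if [measurable]: "X \<in> borel_measurable M" for \<mu>
  proof
    assume "AE w in M. X w = \<mu>"
    then have "distr M borel X = distr M borel (\<lambda>_. \<mu>)"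
      by (intro distr_cong_AE) auto
    also have "\<dots> = distr std_normal_distribution borel (\<lambda>_. \<mu>)"
      by (simp add: distr_const std.distr_const)
    finally show "distr M borel X = distr std_normal_distribution borel (\<lambda>z. \<mu> + 0 * z)"
      by simp
  next
    assume eq: "distr M borel X = distr std_normal_distribution borel (\<lambda>z. \<mu> + 0 * z)"
    have "AE x in distr M borel X. x = \<mu>"
      unfolding eq by (subst AE_distr_iff) auto
    then show "AE w in M. X w = \<mu>"
      by (subst (asm) AE_distr_iff) auto
  qed
  show ?thesis
  proof
    assume "normal_rv M X"
    then consider \<mu> \<sigma> where "X \<in> borel_measurable M" "0 < \<sigma>" "distributed M lborel X (normal_density \<mu> \<sigma>)"
      | \<mu> where "X \<in> borel_measurable M" "AE w in M. X w = \<mu>"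
      unfolding normal_rv_def by blast
    then show "X \<in> borel_measurable M \<and>
      (\<exists>\<mu> \<sigma>. 0 \<le> \<sigma> \<and> distr M borel X = distr std_normal_distribution borel (\<lambda>z. \<mu> + \<sigma> * z))"
    proof cases
      case (1 \<mu> \<sigma>)
      with pos[of \<sigma> \<mu>] show ?thesis
        using less_imp_le[of 0 \<sigma>] by blast
    next
      case (2 \<mu>)
      with zero[of \<mu>] show ?thesis
        by blast
    qed
  next
    assume "X \<in> borel_measurable M \<and>
      (\<exists>\<mu> \<sigma>. 0 \<le> \<sigma> \<and> distr M borel X = distr std_normal_distribution borel (\<lambda>z. \<mu> + \<sigma> * z))"
    then obtain \<mu> \<sigma> where *: "X \<in> borel_measurable M" "0 \<le> \<sigma>"
      "distr M borel X = distr std_normal_distribution borel (\<lambda>z. \<mu> + \<sigma> * z)"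
      by blast
    show "normal_rv M X"
    proof (cases "\<sigma> = 0")
      case True
      with * zero[of \<mu>] show ?thesis
        unfolding normal_rv_def by blast
    next
      case False
      with * have "0 < \<sigma>"
        by simp
      with * pos[of \<sigma> \<mu>] show ?thesis
        unfolding normal_rv_def by blast
    qed
  qed
qed

lemma (in prob_space) normal_rv_cong_AE:
  assumes "random_variable borel X" "random_variable borel Y" "AE w in M. X w = Y w"
  shows "normal_rv M X \<longleftrightarrow> normal_rv M Y"
proof -
  have "distr M borel X = distr M borel Y"
    using assms by (intro distr_cong_AE) auto
  then show ?thesis
    using assms by (simp add: normal_rv_iff_distr[OF prob_space_axioms])
qed

text \<open>Everything is computed for an affine image of a standard normal variable. The middle
  claim is a reverse Hoelder inequality whose constant serves all normal laws; the last one
  expresses the characteristic function through the first two moments.\<close>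

lemma (in prob_space) normal_rv_moments:
  assumes "normal_rv M X"
  shows "integrable M (\<lambda>w. (X w)\<^sup>2)"
    and "sqrt (expectation (\<lambda>w. (X w)\<^sup>2)) \<le> 5 * expectation (\<lambda>w. \<bar>X w\<bar>)"
    and "char (distr M borel X) t =
      iexp (t * expectation X) *
      of_real (exp (- (t\<^sup>2 * (expectation (\<lambda>w. (X w)\<^sup>2) - (expectation X)\<^sup>2)) / 2))"
proof -
  let ?Z = std_normal_distribution
  interpret std: prob_space ?Z
    by (rule prob_space_normal_density) simp
  from assms obtain \<mu> \<sigma> where X[measurable]: "X \<in> borel_measurable M" and "0 \<le> \<sigma>"
    and eq: "distr M borel X = distr ?Z borel (\<lambda>z. \<mu> + \<sigma> * z)"
    unfolding normal_rv_iff_distr[OF prob_space_axioms] by blast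
  have int: "integrable M (\<lambda>w. f (X w)) \<longleftrightarrow> integrable ?Z (\<lambda>z. f (\<mu> + \<sigma> * z))"
    if "f \<in> borel_measurable borel" for f :: "real \<Rightarrow> real"
    using integrable_distr_eq[of X M borel f] integrable_distr_eq[of "\<lambda>z. \<mu> + \<sigma> * z" ?Z borel f] that eq
    by simp
  have expct: "expectation (\<lambda>w. f (X w)) = (\<integral>z. f (\<mu> + \<sigma> * z) \<partial>?Z)"
    if "f \<in> borel_measurable borel" for f :: "real \<Rightarrow> real"
    using integral_distr[of X M borel f] integral_distr[of "\<lambda>z. \<mu> + \<sigma> * z" ?Z borel f] that eq
    by simp
  have sq: "(\<mu> + \<sigma> * z)\<^sup>2 = \<mu>\<^sup>2 + 2 * \<mu> * \<sigma> * z + \<sigma>\<^sup>2 * z\<^sup>2" for z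
    by (simp add: power2_eq_square algebra_simps)
  note [simp] = std_normal_integrals std.prob_space[simplified]
  show X2: "integrable M (\<lambda>w. (X w)\<^sup>2)"
    by (subst int) (auto simp: sq)
  then have X1: "integrable M X"
    by (rule square_integrable_imp_integrable[OF X])
  have EX: "expectation X = \<mu>"
    using expct[of "\<lambda>x. x"] by simp
  have EX2: "expectation (\<lambda>w. (X w)\<^sup>2) = \<mu>\<^sup>2 + \<sigma>\<^sup>2"
    by (subst expct) (auto simp: sq)
  show "char (distr M borel X) t =
      iexp (t * expectation X) *
      of_real (exp (- (t\<^sup>2 * (expectation (\<lambda>w. (X w)\<^sup>2) - (expectation X)\<^sup>2)) / 2))"
    unfolding eq char_affine_std_normal by (simp add: EX EX2)
  have mu: "\<bar>\<mu>\<bar> \<le> expectation (\<lambda>w. \<bar>X w\<bar>)"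
    using integral_abs_bound[of M X] EX by simp
  \<comment> \<open>The first absolute moment sqrt (2 / pi) of the standard normal law is at least
    1/2. Hence sigma / 2 <= E|X - mu| <= E|X| + |mu| <= 2 E|X|, so sigma <= 4 E|X|; adding |mu| <=
    E|X| gives the constant 5.\<close>
  have "\<sigma> * (1 / 2) \<le> \<sigma> * sqrt (2 / pi)"
    using \<open>0 \<le> \<sigma>\<close> pi_less_4 by (intro mult_left_mono real_le_rsqrt) (auto simp: power2_eq_square field_simps)
  also have "\<dots> = expectation (\<lambda>w. \<bar>X w - \<mu>\<bar>)"
    using \<open>0 \<le> \<sigma>\<close> by (subst expct) (auto simp: abs_mult)
  also have "\<dots> \<le> expectation (\<lambda>w. \<bar>X w\<bar> + \<bar>\<mu>\<bar>)"
    using X1 by (intro integral_mono) auto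
  also have "\<dots> = expectation (\<lambda>w. \<bar>X w\<bar>) + \<bar>\<mu>\<bar>"
    using X1 by (simp add: prob_space)
  finally have sigma: "\<sigma> \<le> 4 * expectation (\<lambda>w. \<bar>X w\<bar>)"
    using mu by simp
  have "sqrt (\<mu>\<^sup>2 + \<sigma>\<^sup>2) \<le> \<bar>\<mu>\<bar> + \<bar>\<sigma>\<bar>"
    by (rule sqrt_sum_squares_le_sum_abs)
  then show "sqrt (expectation (\<lambda>w. (X w)\<^sup>2)) \<le> 5 * expectation (\<lambda>w. \<bar>X w\<bar>)"
    using mu sigma \<open>0 \<le> \<sigma>\<close> EX2 by simp
qed

lemma (in prob_space) normal_rvI_char:
  assumes X[measurable]: "random_variable borel X" and "0 \<le> v"
    and char: "\<And>t. char (distr M borel X) t = iexp (t * m) * of_real (exp (- (t\<^sup>2 * v) / 2))"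
  shows "normal_rv M X"
proof -
  interpret std: prob_space std_normal_distribution
    by (rule prob_space_normal_density) simp
  have "distr M borel X = distr std_normal_distribution borel (\<lambda>z. m + sqrt v * z)"
    using assms by (intro Levy_uniqueness) (auto simp: fun_eq_iff char_affine_std_normal)
  then show ?thesis
    unfolding normal_rv_iff_distr[OF prob_space_axioms]
    using X \<open>0 \<le> v\<close> by (metis real_sqrt_ge_zero)
qed

text \<open>A normal characteristic function depends continuously on the first two moments, which
  converge under L^2 convergence. The characteristic functions also converge to that of
  \<open>Y\<close>, because u |-> exp (i t u) is Lipschitz; so the latter has normal form.\<close>

lemma (in prob_space) normal_rv_L2_limit:
  assumes Y[measurable]: "random_variable borel Y" and Y2: "integrable M (\<lambda>w. (Y w)\<^sup>2)"
    and X: "\<And>n. normal_rv M (X n)"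
    and lim: "(\<lambda>n. expectation (\<lambda>w. (X n w - Y w)\<^sup>2)) \<longlonglongrightarrow> 0"
  shows "normal_rv M Y"
proof -
  have [measurable]: "random_variable borel (X n)" for n
    using X[of n] by (simp add: normal_rv_def)
  have X2: "integrable M (\<lambda>w. (X n w)\<^sup>2)" for n
    using normal_rv_moments(1)[OF X] .
  have int: "integrable M Y" "integrable M (X n)" for n
    using Y2 X2[of n] by (simp_all add: square_integrable_imp_integrable)
  have XY: "integrable M (\<lambda>w. X n w * Y w)" for n
    by (rule integrable_mult_of_squares) (auto simp: X2 Y2)
  define D where "D = (\<lambda>n w. X n w - Y w)"
  have [measurable]: "random_variable borel (D n)" for n
    by (simp add: D_def)
  have "integrable M (\<lambda>w. (X n w)\<^sup>2 + (Y w)\<^sup>2 - 2 * (X n w * Y w))" for n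
    using X2 Y2 XY by auto
  then have D2: "integrable M (\<lambda>w. (D n w)\<^sup>2)" for n
    by (simp add: D_def power2_diff mult.assoc)
  then have D1: "integrable M (D n)" for n
    by (simp add: square_integrable_imp_integrable)
  have DY: "integrable M (\<lambda>w. D n w * Y w)" for n
    by (rule integrable_mult_of_squares) (auto simp: D2 Y2)
  have sq0: "(\<lambda>n. sqrt (expectation (\<lambda>w. (D n w)\<^sup>2))) \<longlonglongrightarrow> 0"
    using tendsto_real_sqrt[OF lim] by (simp add: D_def)
  have D0: "(\<lambda>n. expectation (\<lambda>w. \<bar>D n w\<bar>)) \<longlonglongrightarrow> 0"
    by (rule tendsto_sandwich[OF _ _ tendsto_const sq0])
       (auto intro!: always_eventually expectation_abs_le D2)
  \<comment> \<open>The mixed term in E X^2 = E D^2 + 2 E (D Y) + E Y^2.\<close>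
  have DY0: "(\<lambda>n. expectation (\<lambda>w. D n w * Y w)) \<longlonglongrightarrow> 0"
  proof (rule Lim_null_comparison)
    show "\<forall>\<^sub>F n in sequentially. norm (expectation (\<lambda>w. D n w * Y w)) \<le>
        sqrt (expectation (\<lambda>w. (D n w)\<^sup>2)) * sqrt (expectation (\<lambda>w. (Y w)\<^sup>2))"
      using integral_abs_mult_le[OF _ _ D2 Y2] integral_abs_bound[of M "\<lambda>w. D _ w * Y w"]
      by (intro always_eventually allI) (smt (verit) measurable_def real_norm_def \<open>\<And>n. random_variable borel (D n)\<close> Y)
    show "(\<lambda>n. sqrt (expectation (\<lambda>w. (D n w)\<^sup>2)) * sqrt (expectation (\<lambda>w. (Y w)\<^sup>2))) \<longlonglongrightarrow> 0"
      using tendsto_mult_right[OF sq0] by simp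
  qed
  have "(\<lambda>n. expectation (D n)) \<longlonglongrightarrow> 0"
    by (rule Lim_null_comparison[OF _ D0]) (auto intro!: always_eventually integral_abs_bound)
  from tendsto_add[OF this tendsto_const[of "expectation Y"]]
  have EX: "(\<lambda>n. expectation (X n)) \<longlonglongrightarrow> expectation Y"
    using int by (simp add: D_def)
  have "expectation (\<lambda>w. (X n w)\<^sup>2) =
      expectation (\<lambda>w. (D n w)\<^sup>2) + 2 * expectation (\<lambda>w. D n w * Y w) + expectation (\<lambda>w. (Y w)\<^sup>2)" for n
  proof -
    have "(X n w)\<^sup>2 = (D n w)\<^sup>2 + 2 * (D n w * Y w) + (Y w)\<^sup>2" for w
      by (simp add: D_def power2_eq_square algebra_simps)
    then show ?thesis
      using D2 DY Y2 by simp
  qed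
  moreover have "(\<lambda>n. expectation (\<lambda>w. (D n w)\<^sup>2) + 2 * expectation (\<lambda>w. D n w * Y w)
      + expectation (\<lambda>w. (Y w)\<^sup>2)) \<longlonglongrightarrow> 0 + 2 * 0 + expectation (\<lambda>w. (Y w)\<^sup>2)"
    using lim by (intro tendsto_intros DY0) (simp add: D_def)
  ultimately have EX2: "(\<lambda>n. expectation (\<lambda>w. (X n w)\<^sup>2)) \<longlonglongrightarrow> expectation (\<lambda>w. (Y w)\<^sup>2)"
    by simp
  show ?thesis
  proof (rule normal_rvI_char[OF Y])
    show "0 \<le> expectation (\<lambda>w. (Y w)\<^sup>2) - (expectation Y)\<^sup>2"
      using variance_eq[OF int(1) Y2] variance_positive[of Y] by simp
    fix t
    have char: "char (distr M borel V) t = (CLINT w|M. iexp (t * V w))"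
      if "random_variable borel V" for V
      using that unfolding char_def by (subst integral_distr) auto
    have iint: "complex_integrable M (\<lambda>w. iexp (t * V w))" if [measurable]: "random_variable borel V" for V
      by (rule integrable_const_bound[of _ 1]) auto
    have "(\<lambda>n. char (distr M borel (X n)) t - char (distr M borel Y) t) \<longlonglongrightarrow> 0"
    proof (rule Lim_null_comparison)
      have "cmod (char (distr M borel (X n)) t - char (distr M borel Y) t) \<le> \<bar>t\<bar> * expectation (\<lambda>w. \<bar>D n w\<bar>)" for n
      proof -
        have "char (distr M borel (X n)) t - char (distr M borel Y) t
            = (CLINT w|M. iexp (t * X n w) - iexp (t * Y w))"
          by (subst (1 2) char, simp, simp, rule Bochner_Integration.integral_diff[symmetric])
             (intro iint, simp)+
        also have "cmod \<dots> \<le> expectation (\<lambda>w. \<bar>t\<bar> * \<bar>D n w\<bar>)"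
        proof (rule order_trans[OF integral_norm_bound integral_mono])
          fix w
          \<comment> \<open>A factor of modulus 1 is taken out, leaving exp (i t D) - 1, of modulus
            at most |t D|.\<close>
          have "iexp (t * X n w) - iexp (t * Y w) = iexp (t * Y w) * (iexp (t * D n w) - 1)"
            by (simp add: D_def algebra_simps flip: exp_add)
          then have "cmod (iexp (t * X n w) - iexp (t * Y w)) = cmod (iexp (t * D n w) - 1)"
            by (simp add: norm_mult)
          also have "\<dots> \<le> \<bar>t * D n w\<bar>"
            using iexp_approx1[of "t * D n w" 0] by simp
          finally show "cmod (iexp (t * X n w) - iexp (t * Y w)) \<le> \<bar>t\<bar> * \<bar>D n w\<bar>"
            by (simp add: abs_mult)
        qed (use D1 iint in auto)
        finally show ?thesis
          by simp
      qed
      then show "\<forall>\<^sub>F n in sequentially. norm (char (distr M borel (X n)) t - char (distr M borel Y) t)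
          \<le> \<bar>t\<bar> * expectation (\<lambda>w. \<bar>D n w\<bar>)"
        by (intro always_eventually) auto
      show "(\<lambda>n. \<bar>t\<bar> * expectation (\<lambda>w. \<bar>D n w\<bar>)) \<longlonglongrightarrow> 0"
        using tendsto_mult_left[OF D0] by simp
    qed
    then have "(\<lambda>n. char (distr M borel (X n)) t) \<longlonglongrightarrow> char (distr M borel Y) t"
      by (simp add: LIM_zero_iff)
    moreover have "(\<lambda>n. char (distr M borel (X n)) t) \<longlonglongrightarrow> iexp (t * expectation Y) *
        of_real (exp (- (t\<^sup>2 * (expectation (\<lambda>w. (Y w)\<^sup>2) - (expectation Y)\<^sup>2)) / 2))"
      unfolding normal_rv_moments(3)[OF X] by (intro tendsto_intros EX EX2) auto
    ultimately show "char (distr M borel Y) t = iexp (t * expectation Y) *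
        of_real (exp (- (t\<^sup>2 * (expectation (\<lambda>w. (Y w)\<^sup>2) - (expectation Y)\<^sup>2)) / 2))"
      by (rule LIMSEQ_unique)
  qed
qed

lemma square_integrable_add:
  fixes f g :: "'a \<Rightarrow> real"
  assumes "f \<in> borel_measurable M" "g \<in> borel_measurable M"
    and "integrable M (\<lambda>x. (f x)\<^sup>2)" "integrable M (\<lambda>x. (g x)\<^sup>2)"
  shows "integrable M (\<lambda>x. (f x + g x)\<^sup>2)"
proof -
  have "(f x + g x)\<^sup>2 = (f x)\<^sup>2 + (g x)\<^sup>2 + 2 * (f x * g x)" for x
    by (simp add: power2_sum)
  then show ?thesis
    using assms integrable_mult_of_squares[OF assms] by simp
qed

text \<open>Off \<open>A\<close>, Cauchy-Schwarz bounds the first moment by the L^2 norm times sqrt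
  (1/100). After multiplication by the constant 5 of \<open>normal_rv_moments\<close> this is half
  of the norm; absorbing it on the left doubles 5 to 10.\<close>

lemma (in prob_space) normal_rv_L2_le_integral_over_event:
  assumes X: "normal_rv M X" and [measurable]: "A \<in> events" and A: "99 / 100 \<le> prob A"
  shows "sqrt (expectation (\<lambda>w. (X w)\<^sup>2)) \<le> 10 * expectation (\<lambda>w. \<bar>X w\<bar> * indicator A w)"
proof -
  have [measurable]: "random_variable borel X"
    using X by (simp add: normal_rv_def)
  have X2: "integrable M (\<lambda>w. (X w)\<^sup>2)"
    using normal_rv_moments(1)[OF X] .
  then have X1: "integrable M (\<lambda>w. \<bar>X w\<bar>)"
    by (simp add: square_integrable_imp_integrable)
  let ?B = "space M - A"
  have B: "prob ?B \<le> (1 / 10)\<^sup>2"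
    using A by (subst prob_compl) (auto simp: power2_eq_square)
  have int: "integrable M (\<lambda>w. \<bar>X w\<bar> * indicator C w)" if [measurable]: "C \<in> events" for C
    by (rule Bochner_Integration.integrable_bound[OF X1]) (auto simp: indicator_def)
  have "expectation (\<lambda>w. \<bar>X w\<bar> * indicator ?B w) = expectation (\<lambda>w. \<bar>X w * indicator ?B w\<bar>)"
    by (simp add: abs_mult)
  also have "\<dots> \<le> sqrt (expectation (\<lambda>w. (X w)\<^sup>2)) * sqrt (expectation (\<lambda>w. (indicator ?B w)\<^sup>2))"
    by (rule integral_abs_mult_le) (auto simp: X2 indicator_def intro!: integrable_const_bound[of _ 1])
  also have "(\<lambda>w. (indicator ?B w)\<^sup>2) = (indicator ?B :: 'a \<Rightarrow> real)"
    by (auto simp: indicator_def)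
  also have "sqrt (expectation (indicator ?B)) \<le> 1 / 10"
    using real_le_lsqrt[OF _ B] by simp
  finally have small: "expectation (\<lambda>w. \<bar>X w\<bar> * indicator ?B w) \<le> sqrt (expectation (\<lambda>w. (X w)\<^sup>2)) * (1 / 10)"
    by (simp add: mult_left_mono)
  have "expectation (\<lambda>w. \<bar>X w\<bar>) = expectation (\<lambda>w. \<bar>X w\<bar> * indicator A w + \<bar>X w\<bar> * indicator ?B w)"
    by (intro Bochner_Integration.integral_cong) (auto simp: indicator_def)
  also have "\<dots> = expectation (\<lambda>w. \<bar>X w\<bar> * indicator A w) + expectation (\<lambda>w. \<bar>X w\<bar> * indicator ?B w)"
    by (intro Bochner_Integration.integral_add int) auto
  finally show ?thesis
    using small normal_rv_moments(2)[OF X] by simp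
qed

section \<open>Averages of random variables\<close>

text \<open>Maurey's empirical method: each new sample \<open>s n\<close> is chosen so that the squared error grows at
  most by its average, and on average over \<open>s n\<close> the cross term vanishes.\<close>
lemma (in prob_space) empirical_approximation:
  fixes G :: "'b \<Rightarrow> 'a \<Rightarrow> real"
  assumes "prob_space N" and [measurable]: "case_prod G \<in> borel_measurable (N \<Otimes>\<^sub>M M)"
    and G2: "\<And>s. s \<in> space N \<Longrightarrow> integrable M (\<lambda>w. (G s w)\<^sup>2)"
    and B: "\<And>s. s \<in> space N \<Longrightarrow> expectation (\<lambda>w. (G s w)\<^sup>2) \<le> B"
  shows "integrable M (\<lambda>w. (\<integral>s. G s w \<partial>N)\<^sup>2)"
    and "\<exists>s. (\<forall>i<n. s i \<in> space N) \<and>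
      expectation (\<lambda>w. (real n * (\<integral>s. G s w \<partial>N) - (\<Sum>i<n. G (s i) w))\<^sup>2) \<le> real n * B"
proof -
  interpret N: prob_space N by fact
  interpret NM: pair_prob_space N M ..
  interpret MN: pair_prob_space M N ..
  define Y where "Y w = (\<integral>s. G s w \<partial>N)" for w
  have Y_meas[measurable]: "random_variable borel Y"
    unfolding Y_def by measurable
  have GM[measurable]: "random_variable borel (G s)" if "s \<in> space N" for s
    using that by measurable
  \<comment> \<open>\<open>B\<close> bounds the inner integrals and \<open>N\<close> has total mass
    1, which brings \<open>G\<close> and its square within reach of Fubini.\<close>
  have "integrable (N \<Otimes>\<^sub>M M) (\<lambda>p. (case p of (s, w) \<Rightarrow> (G s w)\<^sup>2))"
  proof (rule NM.Fubini_integrable)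
    show "integrable N (\<lambda>s. \<integral>w. norm (case (s, w) of (s, w) \<Rightarrow> (G s w)\<^sup>2) \<partial>M)"
      using B by (intro N.integrable_const_bound[of _ B]) auto
  qed (auto simp: G2)
  then have G2_pair: "integrable (N \<Otimes>\<^sub>M M) (\<lambda>(s, w). (G s w)\<^sup>2)"
    by simp
  then have "integrable (N \<Otimes>\<^sub>M M) (\<lambda>(s, w). G s w)"
    using NM.P.square_integrable_imp_integrable[of "\<lambda>(s, w). G s w"] by (simp add: case_prod_unfold)
  then have AE1: "AE w in M. integrable N (\<lambda>s. G s w)"
    by (rule NM.AE_integrable_snd)
  have AE2: "AE w in M. integrable N (\<lambda>s. (G s w)\<^sup>2)"
    using G2_pair by (rule NM.AE_integrable_snd)
  have V: "integrable M (\<lambda>w. \<integral>s. (G s w)\<^sup>2 \<partial>N)"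
    using G2_pair by (rule NM.integrable_snd)
  have EV: "expectation (\<lambda>w. \<integral>s. (G s w)\<^sup>2 \<partial>N) \<le> B"
  proof -
    have "expectation (\<lambda>w. \<integral>s. (G s w)\<^sup>2 \<partial>N) = (\<integral>s. expectation (\<lambda>w. (G s w)\<^sup>2) \<partial>N)"
      using NM.Fubini_integral[OF G2_pair] .
    also have "\<dots> \<le> (\<integral>s. B \<partial>N)"
      using B NM.integrable_fst[OF G2_pair] by (intro integral_mono) auto
    finally show ?thesis
      by (simp add: N.prob_space)
  qed
  \<comment> \<open>The cross term vanishes because \<open>Y w\<close> is the mean of
    \<open>G s w\<close> over \<open>s\<close>. The quantifier over \<open>a\<close> stands inside
    the almost sure statement because \<open>a\<close> will be the random value
    \<open>e w\<close>.\<close>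
  have var: "AE w in M. \<forall>a. integrable N (\<lambda>s. (a + Y w - G s w)\<^sup>2) \<and>
      (\<integral>s. (a + Y w - G s w)\<^sup>2 \<partial>N) = a\<^sup>2 + (\<integral>s. (G s w)\<^sup>2 \<partial>N) - (Y w)\<^sup>2"
    using AE1 AE2
  proof eventually_elim
    case (elim w)
    have "(a + Y w - G s w)\<^sup>2 = (a + Y w)\<^sup>2 + (G s w)\<^sup>2 - 2 * (a + Y w) * G s w" for a s
      by (simp add: power2_diff)
    with elim show ?case
      by (auto simp: N.prob_space Y_def[symmetric] power2_eq_square algebra_simps)
  qed
  \<comment> \<open>Jensen's inequality, as the nonnegativity of the variance found at
    \<open>a = 0\<close>.\<close>
  have Y_le: "AE w in M. (Y w)\<^sup>2 \<le> (\<integral>s. (G s w)\<^sup>2 \<partial>N)"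
    using var
  proof eventually_elim
    case (elim w)
    have "0 \<le> (\<integral>s. (0 + Y w - G s w)\<^sup>2 \<partial>N)"
      by simp
    with elim[rule_format, of 0] show ?case
      by simp
  qed
  show Y2: "integrable M (\<lambda>w. (\<integral>s. G s w \<partial>N)\<^sup>2)"
    unfolding Y_def[symmetric] by (rule Bochner_Integration.integrable_bound[OF V]) (use Y_le in auto)
  \<comment> \<open>\<open>e\<close> is the error accumulated so far; one more copy of
    \<open>Y\<close> is to be matched by one more sample.\<close>
  have step: "\<exists>s\<in>space N. integrable M (\<lambda>w. (e w + Y w - G s w)\<^sup>2) \<and>
      expectation (\<lambda>w. (e w + Y w - G s w)\<^sup>2) \<le> expectation (\<lambda>w. (e w)\<^sup>2) + B"
    if [measurable]: "random_variable borel e" and e2: "integrable M (\<lambda>w. (e w)\<^sup>2)" for e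
  \<comment> \<open>The squares are integrable for every \<open>s\<close>, so failure means that the
    bound is exceeded at every \<open>s\<close>. Then the average over the probability measure
    \<open>N\<close> exceeds it too.\<close>
  proof (rule ccontr)
    assume contra: "\<not> ?thesis"
    have int: "integrable M (\<lambda>w. (e w + Y w - G s w)\<^sup>2)" if "s \<in> space N" for s
    proof -
      have "integrable M (\<lambda>w. (e w + Y w)\<^sup>2)"
        using Y2 e2 by (intro square_integrable_add) (auto simp: Y_def[symmetric])
      then show ?thesis
        using G2[OF that] that square_integrable_add[of "\<lambda>w. e w + Y w" M "\<lambda>w. - G s w"] by simp
    qed
    have I: "integrable (M \<Otimes>\<^sub>M N) (\<lambda>(w, s). (e w + Y w - G s w)\<^sup>2)"
    proof (rule MN.Fubini_integrable)
      have "integrable M (\<lambda>w. (e w)\<^sup>2 + (\<integral>s. (G s w)\<^sup>2 \<partial>N) - (Y w)\<^sup>2)"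
        using e2 V Y2 by (simp add: Y_def)
      then show "integrable M (\<lambda>w. \<integral>s. norm (case (w, s) of (w, s) \<Rightarrow> (e w + Y w - G s w)\<^sup>2) \<partial>N)"
        by (rule integrable_cong_AE_imp) (use var in auto)
    qed (use var in auto)
    have "(\<integral>s. expectation (\<lambda>w. (e w + Y w - G s w)\<^sup>2) \<partial>N)
        = expectation (\<lambda>w. \<integral>s. (e w + Y w - G s w)\<^sup>2 \<partial>N)"
      using MN.Fubini_integral[OF I] .
    also have "\<dots> \<le> expectation (\<lambda>w. (e w)\<^sup>2 + (\<integral>s. (G s w)\<^sup>2 \<partial>N))"
    proof (rule integral_mono_AE)
      show "integrable M (\<lambda>w. \<integral>s. (e w + Y w - G s w)\<^sup>2 \<partial>N)"
        using MN.integrable_fst[OF I] .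
      show "AE w in M. (\<integral>s. (e w + Y w - G s w)\<^sup>2 \<partial>N) \<le> (e w)\<^sup>2 + (\<integral>s. (G s w)\<^sup>2 \<partial>N)"
        using var by eventually_elim auto
    qed (use e2 V in auto)
    also have "\<dots> \<le> expectation (\<lambda>w. (e w)\<^sup>2) + B"
      using e2 V EV by simp
    finally have "(\<integral>s. expectation (\<lambda>w. (e w + Y w - G s w)\<^sup>2) \<partial>N) \<le> expectation (\<lambda>w. (e w)\<^sup>2) + B" .
    moreover have "expectation (\<lambda>w. (e w)\<^sup>2) + B < (\<integral>s. expectation (\<lambda>w. (e w + Y w - G s w)\<^sup>2) \<partial>N)"
      using MN.integrable_snd[OF I] contra int by (intro N.expectation_greater) (auto simp: not_le)
    ultimately show False
      by simp
  qed
  \<comment> \<open>Square integrability of the error joins the induction hypothesis because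
    \<open>step\<close> asks for it.\<close>
  have "\<exists>s. (\<forall>i<n. s i \<in> space N) \<and>
      integrable M (\<lambda>w. (real n * Y w - (\<Sum>i<n. G (s i) w))\<^sup>2) \<and>
      expectation (\<lambda>w. (real n * Y w - (\<Sum>i<n. G (s i) w))\<^sup>2) \<le> real n * B"
  proof (induction n)
    case (Suc n)
    then obtain s where s: "\<forall>i<n. s i \<in> space N"
      "integrable M (\<lambda>w. (real n * Y w - (\<Sum>i<n. G (s i) w))\<^sup>2)"
      "expectation (\<lambda>w. (real n * Y w - (\<Sum>i<n. G (s i) w))\<^sup>2) \<le> real n * B"
      by blast
    have "random_variable borel (\<lambda>w. real n * Y w - (\<Sum>i<n. G (s i) w))"
      using s(1) by (intro borel_measurable_diff borel_measurable_sum) auto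
    from step[OF this s(2)] obtain x where x: "x \<in> space N"
      "integrable M (\<lambda>w. (real n * Y w - (\<Sum>i<n. G (s i) w) + Y w - G x w)\<^sup>2)"
      "expectation (\<lambda>w. (real n * Y w - (\<Sum>i<n. G (s i) w) + Y w - G x w)\<^sup>2) \<le> real n * B + B"
      using s(3) by force
    have "real (Suc n) * Y w - (\<Sum>i<Suc n. G ((s(n := x)) i) w)
        = real n * Y w - (\<Sum>i<n. G (s i) w) + Y w - G x w" for w
      by (simp add: algebra_simps)
    then show ?case
      using s(1) x by (intro exI[of _ "s(n := x)"]) (auto simp: algebra_simps less_Suc_eq)
  qed simp
  then show "\<exists>s. (\<forall>i<n. s i \<in> space N) \<and>
      expectation (\<lambda>w. (real n * (\<integral>s. G s w \<partial>N) - (\<Sum>i<n. G (s i) w))\<^sup>2) \<le> real n * B"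
    by (auto simp: Y_def)
qed

text \<open>The sum of n samples has squared error at most n B, hence their mean has at most B / n.
  These means are finite combinations, thus normal, and converge in L^2.\<close>

lemma (in prob_space) normal_rv_average:
  fixes G :: "'b \<Rightarrow> 'a \<Rightarrow> real"
  assumes "prob_space N" and [measurable]: "case_prod G \<in> borel_measurable (N \<Otimes>\<^sub>M M)"
    and G2: "\<And>s. s \<in> space N \<Longrightarrow> integrable M (\<lambda>w. (G s w)\<^sup>2)"
    and B: "\<And>s. s \<in> space N \<Longrightarrow> expectation (\<lambda>w. (G s w)\<^sup>2) \<le> B"
    and normal: "\<And>n s (c :: nat \<Rightarrow> real). (\<And>i. i < n \<Longrightarrow> s i \<in> space N) \<Longrightarrow> normal_rv M (\<lambda>w. \<Sum>i<n. c i * G (s i) w)"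
  shows "normal_rv M (\<lambda>w. \<integral>s. G s w \<partial>N)"
proof -
  interpret N: prob_space N by fact
  define Y where "Y w = (\<integral>s. G s w \<partial>N)" for w
  have Y_meas[measurable]: "random_variable borel Y"
    unfolding Y_def by measurable
  \<comment> \<open>\<open>Suc n\<close> samples, so that the mean never divides by 0.\<close>
  have "\<exists>s. (\<forall>i<Suc n. s i \<in> space N) \<and>
      expectation (\<lambda>w. (real (Suc n) * Y w - (\<Sum>i<Suc n. G (s i) w))\<^sup>2) \<le> real (Suc n) * B" for n
    unfolding Y_def by (rule empirical_approximation(2)[OF assms(1,2) G2 B])
  then obtain s where s: "\<And>n i. i < Suc n \<Longrightarrow> s n i \<in> space N"
    and le: "\<And>n. expectation (\<lambda>w. (real (Suc n) * Y w - (\<Sum>i<Suc n. G (s n i) w))\<^sup>2) \<le> real (Suc n) * B"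
    by metis
  define X where "X n w = (\<Sum>i<Suc n. 1 / real (Suc n) * G (s n i) w)" for n w
  have "normal_rv M Y"
  proof (rule normal_rv_L2_limit)
    show "integrable M (\<lambda>w. (Y w)\<^sup>2)"
      unfolding Y_def by (rule empirical_approximation(1)[OF assms(1,2) G2 B])
    show "normal_rv M (X n)" for n
      unfolding X_def by (rule normal) (rule s)
    have bound: "expectation (\<lambda>w. (X n w - Y w)\<^sup>2) \<le> B / real (Suc n)" for n
    proof -
      have "(X n w - Y w)\<^sup>2 = (1 / real (Suc n))\<^sup>2 * (real (Suc n) * Y w - (\<Sum>i<Suc n. G (s n i) w))\<^sup>2" for w
      proof -
        have "X n w - Y w = - (1 / real (Suc n)) * (real (Suc n) * Y w - (\<Sum>i<Suc n. G (s n i) w))"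
          unfolding X_def sum_distrib_left[symmetric] by (simp add: field_simps del: sum.lessThan_Suc of_nat_Suc)
        then show ?thesis
          by (simp only: power_mult_distrib power2_minus)
      qed
      then have "expectation (\<lambda>w. (X n w - Y w)\<^sup>2) \<le> (1 / real (Suc n))\<^sup>2 * (real (Suc n) * B)"
        using le[of n] by (simp add: mult_left_mono del: sum.lessThan_Suc of_nat_Suc)
      also have "\<dots> = B / real (Suc n)"
        by (simp add: power2_eq_square del: of_nat_Suc)
      finally show ?thesis .
    qed
    have "(\<lambda>n. B / real (Suc n)) \<longlonglongrightarrow> 0"
      using LIMSEQ_inverse_real_of_nat[THEN tendsto_mult_right, of B] by (simp add: field_simps)
    from tendsto_sandwich[OF _ _ tendsto_const this]
    show "(\<lambda>n. expectation (\<lambda>w. (X n w - Y w)\<^sup>2)) \<longlonglongrightarrow> 0"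
      using bound by (simp add: always_eventually del: of_nat_Suc)
  qed fact
  then show ?thesis
    by (simp add: Y_def[abs_def])
qed

section \<open>Weighted integrals of Gaussian fields\<close>

text \<open>Centring one factor suffices, since the mean of the other then multiplies an expectation
  that is 0. This has the form E (X Z), linear in \<open>X\<close>, in which an integral can be
  exchanged with the expectation.\<close>

lemma (in prob_space) covariance_eq_expectation_centered:
  assumes [measurable]: "random_variable borel X" "random_variable borel Y"
    and X2: "integrable M (\<lambda>w. (X w)\<^sup>2)" and Y2: "integrable M (\<lambda>w. (Y w)\<^sup>2)"
  shows "covariance M X Y = expectation (\<lambda>w. X w * (Y w - expectation Y))"
proof -
  have int: "integrable M X" "integrable M Y" "integrable M (\<lambda>w. X w * Y w)"
    using X2 Y2 by (auto simp: square_integrable_imp_integrable integrable_mult_of_squares)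
  then have "covariance M X Y =
      expectation (\<lambda>w. X w * (Y w - expectation Y)) - expectation X * expectation (\<lambda>w. Y w - expectation Y)"
    unfolding covariance_def by (simp add: algebra_simps)
  then show ?thesis
    using int by (simp add: prob_space)
qed

lemma covariance_commute: "covariance M X Y = covariance M Y X"
  by (simp add: covariance_def mult.commute)

lemma covariance_cong_AE:
  assumes "X \<in> borel_measurable M" "X' \<in> borel_measurable M" "AE w in M. X w = X' w"
    and "Y \<in> borel_measurable M" "Y' \<in> borel_measurable M" "AE w in M. Y w = Y' w"
  shows "covariance M X Y = covariance M X' Y'"
proof -
  have "(\<integral>w. X w \<partial>M) = (\<integral>w. X' w \<partial>M)" "(\<integral>w. Y w \<partial>M) = (\<integral>w. Y' w \<partial>M)"
    using assms by (auto intro!: integral_cong_AE)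
  then show ?thesis
    unfolding covariance_def using assms by (intro integral_cong_AE) auto
qed

lemma (in prob_space) square_integrable_centered:
  assumes [measurable]: "random_variable borel X" and X2: "integrable M (\<lambda>w. (X w)\<^sup>2)"
  shows "integrable M (\<lambda>w. (X w - c :: real)\<^sup>2)"
  using square_integrable_add[OF _ _ X2, of "\<lambda>_. - c"] by simp

text \<open>The index space is any finite measure space, later an interval with Lebesgue measure.
  Finiteness makes constants integrable, on which the density proportional to 1 + \<open>L2\<close>
  relies.\<close>

locale gaussian_field = prob_space M + N: finite_measure N
  for M :: "'w measure" and N :: "'s measure" +
  fixes X :: "'s \<Rightarrow> 'w \<Rightarrow> real"
  assumes X_measurable[measurable]: "case_prod X \<in> borel_measurable (N \<Otimes>\<^sub>M M)"
    and normal_combination: "\<And>n s (c :: nat \<Rightarrow> real). (\<And>i. i < n \<Longrightarrow> s i \<in> space N) \<Longrightarrow>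
      normal_rv M (\<lambda>w. \<Sum>i<n. c i * X (s i) w)"
    and integrable_paths: "AE w in M. integrable N (\<lambda>s. X s w)"
begin

sublocale NM: pair_sigma_finite N M ..

lemma X_rv[measurable]: "s \<in> space N \<Longrightarrow> random_variable borel (X s)"
  by measurable

lemma normal_X: "s \<in> space N \<Longrightarrow> normal_rv M (X s)"
  using normal_combination[of "Suc 0" "\<lambda>_. s" "\<lambda>_. 1"] by simp

lemma X_square_integrable: "s \<in> space N \<Longrightarrow> integrable M (\<lambda>w. (X s w)\<^sup>2)"
  by (rule normal_rv_moments(1)[OF normal_X])

definition L2 :: "'s \<Rightarrow> real" where
  "L2 s = sqrt (expectation (\<lambda>w. (X s w)\<^sup>2))"

lemma L2_nonneg: "0 \<le> L2 s"
  by (simp add: L2_def)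

lemma L2_measurable[measurable]: "L2 \<in> borel_measurable N"
  unfolding L2_def by measurable

text \<open>The paths are integrable up to a bound \<open>n\<close> outside an event of small probability, and removing
  such an event decreases the first moment of a normal variable at most by a universal factor.\<close>
lemma L2_integrable: "integrable N L2"
proof -
  define J where "J w = (\<integral>\<^sup>+s. ennreal \<bar>X s w\<bar> \<partial>N)" for w
  have J[measurable]: "J \<in> borel_measurable M"
    unfolding J_def by measurable
  define A where "A n = {w \<in> space M. J w \<le> of_nat n}" for n
  have A[measurable]: "A n \<in> events" for n
    unfolding A_def by measurable
  have "AE w in M. w \<in> (\<Union>n. A n)"
    using integrable_paths AE_space
  proof eventually_elim
    case (elim w)
    then have "J w < \<infinity>"
      by (simp add: J_def integrable_iff_bounded)
    then obtain r where r: "J w = ennreal r"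
      by (cases "J w") auto
    obtain n where "r \<le> real n"
      using real_arch_simple by blast
    then have "J w \<le> of_nat n"
      by (simp add: r ennreal_of_nat_eq_real_of_nat ennreal_leI)
    with elim show ?case
      by (auto simp: A_def)
  qed
  then have "prob (\<Union>n. A n) = 1"
    by (subst prob_eq_1) auto
  moreover have "(\<lambda>n. prob (A n)) \<longlonglongrightarrow> prob (\<Union>n. A n)"
    by (rule finite_Lim_measure_incseq) (auto simp: A_def incseq_def intro: order_trans)
  ultimately have "(\<lambda>n. prob (A n)) \<longlonglongrightarrow> 1"
    by simp
  \<comment> \<open>99/100 is the threshold of
    \<open>normal_rv_L2_le_integral_over_event\<close>.\<close>
  then have "\<forall>\<^sub>F n in sequentially. 99 / 100 < prob (A n)"
    by (rule order_tendstoD(1)) simp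
  then obtain n where n: "99 / 100 < prob (A n)"
    by (auto simp: eventually_sequentially)
  have "(\<integral>\<^sup>+s. ennreal (L2 s) \<partial>N) \<le> (\<integral>\<^sup>+s. 10 * (\<integral>\<^sup>+w. ennreal (\<bar>X s w\<bar> * indicator (A n) w) \<partial>M) \<partial>N)"
  proof (rule nn_integral_mono)
    fix s assume s: "s \<in> space N"
    have X1: "integrable M (\<lambda>w. \<bar>X s w\<bar>)"
      using X_square_integrable[OF s] s by (simp add: square_integrable_imp_integrable)
    have "integrable M (\<lambda>w. \<bar>X s w\<bar> * indicator (A n) w)"
      by (rule Bochner_Integration.integrable_bound[OF X1]) (use s in \<open>auto simp: indicator_def\<close>)
    then have "(\<integral>\<^sup>+w. ennreal (\<bar>X s w\<bar> * indicator (A n) w) \<partial>M) = expectation (\<lambda>w. \<bar>X s w\<bar> * indicator (A n) w)"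
      by (intro nn_integral_eq_integral) auto
    moreover have "L2 s \<le> 10 * expectation (\<lambda>w. \<bar>X s w\<bar> * indicator (A n) w)"
      unfolding L2_def by (rule normal_rv_L2_le_integral_over_event[OF normal_X[OF s] A]) (use n in simp)
    ultimately show "ennreal (L2 s) \<le> 10 * (\<integral>\<^sup>+w. ennreal (\<bar>X s w\<bar> * indicator (A n) w) \<partial>M)"
      by (simp add: ennreal_mult'[symmetric] ennreal_leI flip: ennreal_numeral)
  qed
  also have "\<dots> = 10 * (\<integral>\<^sup>+s. (\<integral>\<^sup>+w. ennreal (\<bar>X s w\<bar> * indicator (A n) w) \<partial>M) \<partial>N)"
    by (rule nn_integral_cmult) measurable
  \<comment> \<open>Tonelli for nonnegative integrals, as integrability is still to be proved. On
    \<open>A n\<close> the inner integral is \<open>J\<close>, which is at most \<open>n\<close>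
    there.\<close>
  also have "(\<integral>\<^sup>+s. (\<integral>\<^sup>+w. ennreal (\<bar>X s w\<bar> * indicator (A n) w) \<partial>M) \<partial>N)
      = (\<integral>\<^sup>+w. (\<integral>\<^sup>+s. ennreal (\<bar>X s w\<bar> * indicator (A n) w) \<partial>N) \<partial>M)"
    by (rule NM.Fubini'[symmetric]) measurable
  also have "\<dots> = (\<integral>\<^sup>+w. J w * indicator (A n) w \<partial>M)"
    by (intro nn_integral_cong) (auto simp: J_def indicator_def)
  also have "\<dots> \<le> (\<integral>\<^sup>+w. of_nat n \<partial>M)"
    by (intro nn_integral_mono) (auto simp: A_def indicator_def)
  also have "\<dots> = of_nat n"
    by (simp add: emeasure_space_1)
  finally have "(\<integral>\<^sup>+s. ennreal (L2 s) \<partial>N) \<le> 10 * of_nat n"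
    by (simp add: mult_left_mono)
  also have "\<dots> < \<infinity>"
    by (simp add: ennreal_mult_less_top of_nat_less_top)
  finally show ?thesis
    by (intro integrableI_nonneg) (auto simp: L2_nonneg)
qed

text \<open>Bounded weights keep the weighted field dominated in norm by a multiple of
  \<open>L2\<close>. They include the cut-off exponential kernels and are closed under linear
  combinations.\<close>

definition bounded_weight :: "('s \<Rightarrow> real) \<Rightarrow> bool" where
  "bounded_weight g \<longleftrightarrow> g \<in> borel_measurable N \<and> (\<exists>C. \<forall>s\<in>space N. \<bar>g s\<bar> \<le> C)"

definition weighted_integral :: "('s \<Rightarrow> real) \<Rightarrow> 'w \<Rightarrow> real" where
  "weighted_integral g w = (\<integral>s. g s * X s w \<partial>N)"

lemma bounded_weight_measurable[measurable_dest]: "bounded_weight g \<Longrightarrow> g \<in> borel_measurable N"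
  by (simp add: bounded_weight_def)

lemma weighted_integral_measurable[measurable]:
  assumes "bounded_weight g"
  shows "random_variable borel (weighted_integral g)"
proof -
  have [measurable]: "g \<in> borel_measurable N"
    using assms by (rule bounded_weight_measurable)
  show ?thesis
    unfolding weighted_integral_def by measurable
qed

text \<open>By Cauchy-Schwarz E|g X Z| is at most \<open>C * L2 s\<close> times the norm of
  \<open>Z\<close>, and this is integrable in \<open>s\<close>, so Fubini applies. The test variable
  1 yields means, a centred one yields covariances.\<close>

lemma weighted_integral_times:
  assumes g: "bounded_weight g" and [measurable]: "random_variable borel Z"
    and Z2: "integrable M (\<lambda>w. (Z w)\<^sup>2)"
  shows "integrable N (\<lambda>s. g s * expectation (\<lambda>w. X s w * Z w))"
    and "AE w in M. integrable N (\<lambda>s. g s * X s w * Z w)"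
    and "expectation (\<lambda>w. weighted_integral g w * Z w) = (\<integral>s. g s * expectation (\<lambda>w. X s w * Z w) \<partial>N)"
proof -
  have [measurable]: "g \<in> borel_measurable N"
    using g by (rule bounded_weight_measurable)
  obtain C where C: "\<And>s. s \<in> space N \<Longrightarrow> \<bar>g s\<bar> \<le> C"
    using g by (auto simp: bounded_weight_def)
  have XZ: "integrable M (\<lambda>w. X s w * Z w)" if "s \<in> space N" for s
    using that X_square_integrable[OF that] Z2 by (intro integrable_mult_of_squares) auto
  have int: "integrable (N \<Otimes>\<^sub>M M) (\<lambda>(s, w). g s * X s w * Z w)"
  proof (rule NM.Fubini_integrable)
    show "integrable N (\<lambda>s. \<integral>w. norm (case (s, w) of (s, w) \<Rightarrow> g s * X s w * Z w) \<partial>M)"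
    proof (rule Bochner_Integration.integrable_bound)
      show "integrable N (\<lambda>s. C * (L2 s * sqrt (expectation (\<lambda>w. (Z w)\<^sup>2))))"
        using L2_integrable by auto
      have "(\<integral>w. \<bar>g s * X s w * Z w\<bar> \<partial>M) \<le> C * (L2 s * sqrt (expectation (\<lambda>w. (Z w)\<^sup>2)))"
        if s: "s \<in> space N" for s
      proof -
        have "(\<integral>w. \<bar>g s * X s w * Z w\<bar> \<partial>M) = \<bar>g s\<bar> * (\<integral>w. \<bar>X s w * Z w\<bar> \<partial>M)"
          by (simp add: abs_mult mult.assoc)
        also have "\<dots> \<le> C * (L2 s * sqrt (expectation (\<lambda>w. (Z w)\<^sup>2)))"
          unfolding L2_def using s X_square_integrable[OF s] Z2 C[OF s]
          by (intro mult_mono integral_abs_mult_le) auto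
        finally show ?thesis .
      qed
      then show "AE s in N. norm (\<integral>w. norm (case (s, w) of (s, w) \<Rightarrow> g s * X s w * Z w) \<partial>M)
          \<le> norm (C * (L2 s * sqrt (expectation (\<lambda>w. (Z w)\<^sup>2))))"
        by (auto intro: order_trans[OF _ abs_ge_self])
    qed auto
    show "AE s in N. integrable M (\<lambda>w. case (s, w) of (s, w) \<Rightarrow> g s * X s w * Z w)"
      using XZ by (auto simp: mult.assoc)
  qed auto
  show "integrable N (\<lambda>s. g s * expectation (\<lambda>w. X s w * Z w))"
    using NM.integrable_fst[OF int] by (simp add: mult.assoc)
  show "AE w in M. integrable N (\<lambda>s. g s * X s w * Z w)"
    using NM.AE_integrable_snd[OF int] .
  show "expectation (\<lambda>w. weighted_integral g w * Z w) = (\<integral>s. g s * expectation (\<lambda>w. X s w * Z w) \<partial>N)"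
  proof -
    have "(\<integral>s. g s * X s w * Z w \<partial>N) = weighted_integral g w * Z w" for w
      by (simp add: weighted_integral_def)
    moreover have "g s * expectation (\<lambda>w. X s w * Z w) = expectation (\<lambda>w. g s * X s w * Z w)" for s
      by (simp add: mult.assoc)
    ultimately show ?thesis
      using NM.Fubini_integral[OF int] by (simp only:)
  qed
qed

lemma weighted_integral_expectation:
  assumes "bounded_weight g"
  shows "integrable N (\<lambda>s. g s * expectation (X s))"
    and "AE w in M. integrable N (\<lambda>s. g s * X s w)"
    and "expectation (weighted_integral g) = (\<integral>s. g s * expectation (X s) \<partial>N)"
  using weighted_integral_times[OF assms, of "\<lambda>_. 1"] by simp_all

lemma weighted_integral_normal:
  assumes g: "bounded_weight g"
  shows "integrable M (\<lambda>w. (weighted_integral g w)\<^sup>2)" and "normal_rv M (weighted_integral g)"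
proof -
  have [measurable]: "g \<in> borel_measurable N"
    using g by (rule bounded_weight_measurable)
  obtain C where C: "\<And>s. s \<in> space N \<Longrightarrow> \<bar>g s\<bar> \<le> C"
    using g by (auto simp: bounded_weight_def)
  define L where "L = (\<integral>s. 1 + L2 s \<partial>N)"
  have "integrable M (\<lambda>w. (weighted_integral g w)\<^sup>2) \<and> normal_rv M (weighted_integral g)"
  \<comment> \<open>For a null measure \<open>N\<close> the constant \<open>L\<close> is 0 and
    cannot normalise a density, but the integral is identically 0.\<close>
  proof (cases "emeasure N (space N) = 0")
    case True
    then have "weighted_integral g = (\<lambda>_. 0)"
      by (auto simp: weighted_integral_def fun_eq_iff space_empty_iff intro!: integral_eq_zero_AE AE_I[of _ _ "space N"])
    then show ?thesis
      using normal_combination[of 0] by simp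
  next
    case False
    have "0 < measure N (space N)"
      using False by (simp add: N.emeasure_eq_measure less_le)
    also have "measure N (space N) = (\<integral>s. 1 \<partial>N)"
      by simp
    also have "\<dots> \<le> L"
      unfolding L_def using L2_integrable L2_nonneg by (intro integral_mono) auto
    finally have "0 < L" .
    \<comment> \<open>\<open>G\<close> carries the reciprocal density, so its integral against
      \<open>P\<close> is the weighted integral. The quotient L2 / (1 + L2) is at most 1, which
      keeps its second moments below (L C)^2.\<close>
    define P where "P = density N (\<lambda>s. ennreal ((1 + L2 s) / L))"
    define G where "G s w = L * g s / (1 + L2 s) * X s w" for s w
    have nn: "0 \<le> (1 + L2 s) / L" and pos: "1 + L2 s > 0" for s
      using \<open>0 < L\<close> L2_nonneg[of s] by (auto intro: add_pos_nonneg)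
    have sets_P[measurable_cong]: "sets P = sets N" and space_P: "space P = space N"
      by (simp_all add: P_def)
    have "prob_space P"
    proof
      have "emeasure P (space P) = (\<integral>\<^sup>+s. ennreal ((1 + L2 s) / L) \<partial>N)"
        by (simp add: P_def emeasure_density cong: nn_integral_cong)
      also have "\<dots> = ennreal (\<integral>s. (1 + L2 s) / L \<partial>N)"
        using L2_integrable nn by (intro nn_integral_eq_integral) auto
      also have "(\<integral>s. (1 + L2 s) / L \<partial>N) = 1"
        using \<open>0 < L\<close> by (simp add: L_def[symmetric])
      finally show "emeasure P (space P) = 1"
        by simp
    qed
    have eq: "(\<integral>s. G s w \<partial>P) = weighted_integral g w" if "w \<in> space M" for w
    proof -
      have [measurable]: "(\<lambda>s. X s w) \<in> borel_measurable N"
        using that by measurable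
      have "(\<integral>s. G s w \<partial>P) = (\<integral>s. ((1 + L2 s) / L) *\<^sub>R G s w \<partial>N)"
        unfolding P_def using nn by (intro integral_density) (auto simp: G_def)
      also have "\<dots> = weighted_integral g w"
        unfolding weighted_integral_def
      proof (rule Bochner_Integration.integral_cong)
        have "a / L * (L * b / a * x) = b * x" if "0 < a" for a b x :: real
          using that \<open>0 < L\<close> by (simp add: field_simps)
        then show "((1 + L2 s) / L) *\<^sub>R G s w = g s * X s w" for s
          using pos[of s] by (simp add: G_def)
      qed simp
      finally show ?thesis .
    qed
    have meas: "case_prod G \<in> borel_measurable (P \<Otimes>\<^sub>M M)"
      unfolding G_def by measurable
    have G2: "(G s w)\<^sup>2 = (L * g s / (1 + L2 s))\<^sup>2 * (X s w)\<^sup>2" for s w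
      by (simp add: G_def flip: power_mult_distrib)
    have int: "integrable M (\<lambda>w. (G s w)\<^sup>2)" if "s \<in> space P" for s
      using that X_square_integrable by (simp add: G2 space_P)
    have bound: "expectation (\<lambda>w. (G s w)\<^sup>2) \<le> (L * C)\<^sup>2" if "s \<in> space P" for s
    proof -
      have s: "s \<in> space N"
        using that by (simp add: space_P)
      have "expectation (\<lambda>w. (G s w)\<^sup>2) = (L * g s / (1 + L2 s))\<^sup>2 * (L2 s)\<^sup>2"
        by (simp add: G2 L2_def)
      also have "\<dots> = (L * \<bar>g s\<bar> * (L2 s / (1 + L2 s)))\<^sup>2"
        by (simp add: power_mult_distrib power_divide)
      also have "\<dots> \<le> (L * C * 1)\<^sup>2"
        using \<open>0 < L\<close> C[OF s] L2_nonneg[of s] abs_ge_zero[of "g s"]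
        by (intro power_mono mult_mono) auto
      finally show ?thesis
        by simp
    qed
    have normal: "normal_rv M (\<lambda>w. \<Sum>i<n. c i * G (s i) w)"
      if "\<And>i. i < n \<Longrightarrow> s i \<in> space P" for n s and c :: "nat \<Rightarrow> real"
      using normal_combination[of n s "\<lambda>i. c i * (L * g (s i) / (1 + L2 (s i)))"] that
      by (simp add: G_def space_P mult.assoc)
    have "integrable M (\<lambda>w. (\<integral>s. G s w \<partial>P)\<^sup>2)"
      by (rule empirical_approximation(1)[OF \<open>prob_space P\<close> meas int bound])
    moreover have "normal_rv M (\<lambda>w. \<integral>s. G s w \<partial>P)"
      by (rule normal_rv_average[OF \<open>prob_space P\<close> meas int bound normal])
    \<comment> \<open>\<open>eq\<close> is available on \<open>space M\<close> only, so normality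
      passes through almost sure equality.\<close>
    moreover have "normal_rv M (\<lambda>w. \<integral>s. G s w \<partial>P) \<longleftrightarrow> normal_rv M (weighted_integral g)"
      by (rule normal_rv_cong_AE) (use eq weighted_integral_measurable[OF g] calculation in \<open>auto simp: normal_rv_def\<close>)
    ultimately show ?thesis
      using eq by (simp cong: Bochner_Integration.integrable_cong)
  qed
  then show "integrable M (\<lambda>w. (weighted_integral g w)\<^sup>2)" and "normal_rv M (weighted_integral g)"
    by simp_all
qed

lemma weighted_integral_covariance:
  assumes g: "bounded_weight g" and [measurable]: "random_variable borel Z"
    and Z2: "integrable M (\<lambda>w. (Z w)\<^sup>2)"
  shows "integrable N (\<lambda>s. g s * covariance M (X s) Z)"
    and "covariance M (weighted_integral g) Z = (\<integral>s. g s * covariance M (X s) Z \<partial>N)"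
proof -
  have centered: "integrable M (\<lambda>w. (Z w - expectation Z)\<^sup>2)"
    using Z2 by (simp add: square_integrable_centered)
  have cov: "covariance M (X s) Z = expectation (\<lambda>w. X s w * (Z w - expectation Z))" if "s \<in> space N" for s
    using that X_square_integrable Z2 by (intro covariance_eq_expectation_centered) auto
  show "integrable N (\<lambda>s. g s * covariance M (X s) Z)"
    using weighted_integral_times(1)[OF g _ centered] cov
    by (subst Bochner_Integration.integrable_cong[OF refl]) auto
  have "covariance M (weighted_integral g) Z = expectation (\<lambda>w. weighted_integral g w * (Z w - expectation Z))"
    using weighted_integral_measurable[OF g] weighted_integral_normal(1)[OF g] Z2
    by (intro covariance_eq_expectation_centered) auto
  also have "\<dots> = (\<integral>s. g s * covariance M (X s) Z \<partial>N)"
    using weighted_integral_times(3)[OF g _ centered] cov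
    by (simp cong: Bochner_Integration.integral_cong)
  finally show "covariance M (weighted_integral g) Z = (\<integral>s. g s * covariance M (X s) Z \<partial>N)" .
qed

text \<open>\<open>weighted_integral_covariance\<close> is used twice: with the integral of
  \<open>h\<close> as \<open>Z\<close> for the outer integral, and, by symmetry of the covariance,
  with the single variable \<open>X s\<close> as \<open>Z\<close> for the inner one.\<close>

lemma weighted_integrals_covariance:
  assumes g: "bounded_weight g" and h: "bounded_weight h"
  shows "s \<in> space N \<Longrightarrow> integrable N (\<lambda>s'. h s' * covariance M (X s) (X s'))"
    and "integrable N (\<lambda>s. g s * (\<integral>s'. h s' * covariance M (X s) (X s') \<partial>N))"
    and "covariance M (weighted_integral g) (weighted_integral h) =
      (\<integral>s. g s * (\<integral>s'. h s' * covariance M (X s) (X s') \<partial>N) \<partial>N)"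
proof -
  have inner: "covariance M (X s) (weighted_integral h) = (\<integral>s'. h s' * covariance M (X s) (X s') \<partial>N)"
    if "s \<in> space N" for s
    using weighted_integral_covariance(2)[OF h _ X_square_integrable[OF that]] that
    by (simp add: covariance_commute[of M "X s"])
  show "integrable N (\<lambda>s'. h s' * covariance M (X s) (X s'))" if "s \<in> space N"
    using weighted_integral_covariance(1)[OF h _ X_square_integrable[OF that]] that
    by (simp add: covariance_commute[of M "X s"])
  note outer = weighted_integral_covariance[OF g weighted_integral_measurable[OF h] weighted_integral_normal(1)[OF h]]
  show "integrable N (\<lambda>s. g s * (\<integral>s'. h s' * covariance M (X s) (X s') \<partial>N))"
    using outer(1) inner by (simp cong: Bochner_Integration.integrable_cong)
  show "covariance M (weighted_integral g) (weighted_integral h) =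
      (\<integral>s. g s * (\<integral>s'. h s' * covariance M (X s) (X s') \<partial>N) \<partial>N)"
    using outer(2) inner by (simp cong: Bochner_Integration.integral_cong)
qed

end

section \<open>Sums of random variables and linear combinations of weighted integrals\<close>

lemma (in prob_space) covariance_sum:
  fixes X :: "'i \<Rightarrow> 'a \<Rightarrow> real" and Y :: "'j \<Rightarrow> 'a \<Rightarrow> real"
  assumes [measurable]: "\<And>i. i \<in> I \<Longrightarrow> random_variable borel (X i)" "\<And>j. j \<in> J \<Longrightarrow> random_variable borel (Y j)"
    and X2: "\<And>i. i \<in> I \<Longrightarrow> integrable M (\<lambda>w. (X i w)\<^sup>2)"
    and Y2: "\<And>j. j \<in> J \<Longrightarrow> integrable M (\<lambda>w. (Y j w)\<^sup>2)"
  shows "covariance M (\<lambda>w. \<Sum>i\<in>I. X i w) (\<lambda>w. \<Sum>j\<in>J. Y j w) = (\<Sum>i\<in>I. \<Sum>j\<in>J. covariance M (X i) (Y j))"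
proof -
  have "integrable M (X i)" if "i \<in> I" for i
    using that X2 by (simp add: square_integrable_imp_integrable)
  then have EX: "expectation (\<lambda>w. \<Sum>i\<in>I. X i w) = (\<Sum>i\<in>I. expectation (X i))"
    by (rule Bochner_Integration.integral_sum)
  have "integrable M (Y j)" if "j \<in> J" for j
    using that Y2 by (simp add: square_integrable_imp_integrable)
  then have EY: "expectation (\<lambda>w. \<Sum>j\<in>J. Y j w) = (\<Sum>j\<in>J. expectation (Y j))"
    by (rule Bochner_Integration.integral_sum)
  have int: "integrable M (\<lambda>w. (X i w - expectation (X i)) * (Y j w - expectation (Y j)))" if "i \<in> I" "j \<in> J" for i j
    using that X2 Y2 by (intro integrable_mult_of_squares square_integrable_centered) auto
  have "covariance M (\<lambda>w. \<Sum>i\<in>I. X i w) (\<lambda>w. \<Sum>j\<in>J. Y j w) =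
      expectation (\<lambda>w. \<Sum>i\<in>I. \<Sum>j\<in>J. (X i w - expectation (X i)) * (Y j w - expectation (Y j)))"
    by (simp add: covariance_def EX EY sum_subtractf[symmetric] sum_product)
  also have "\<dots> = (\<Sum>i\<in>I. \<Sum>j\<in>J. covariance M (X i) (Y j))"
    unfolding covariance_def using int by (simp add: Bochner_Integration.integral_sum Bochner_Integration.integrable_sum)
  finally show ?thesis .
qed

context gaussian_field
begin

lemma bounded_weight_cmult: "bounded_weight g \<Longrightarrow> bounded_weight (\<lambda>s. c * g s)"
  unfolding bounded_weight_def
proof safe
  fix C assume "\<forall>s\<in>space N. \<bar>g s\<bar> \<le> C"
  then have "\<forall>s\<in>space N. \<bar>c * g s\<bar> \<le> \<bar>c\<bar> * C"
    by (simp add: abs_mult mult_left_mono)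
  then show "\<exists>C. \<forall>s\<in>space N. \<bar>c * g s\<bar> \<le> C"
    by blast
qed auto

lemma bounded_weight_sum:
  assumes "\<And>x. x \<in> A \<Longrightarrow> bounded_weight (g x)"
  shows "bounded_weight (\<lambda>s. \<Sum>x\<in>A. g x s)"
proof -
  from assms obtain C where C: "\<And>x s. x \<in> A \<Longrightarrow> s \<in> space N \<Longrightarrow> \<bar>g x s\<bar> \<le> C x"
    unfolding bounded_weight_def by metis
  have "\<bar>\<Sum>x\<in>A. g x s\<bar> \<le> (\<Sum>x\<in>A. C x)" if "s \<in> space N" for s
    using C that by (intro order_trans[OF sum_abs sum_mono])
  then show ?thesis
    using assms by (auto simp: bounded_weight_def intro!: borel_measurable_sum)
qed

text \<open>Only almost sure, since linearity requires every summand to be integrable along the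
  path.\<close>

lemma weighted_integral_sum:
  assumes "finite A" and g: "\<And>x. x \<in> A \<Longrightarrow> bounded_weight (g x)"
  shows "AE w in M. weighted_integral (\<lambda>s. \<Sum>x\<in>A. c x * g x s) w = (\<Sum>x\<in>A. c x * weighted_integral (g x) w)"
proof -
  have "AE w in M. \<forall>x\<in>A. integrable N (\<lambda>s. g x s * X s w)"
    using \<open>finite A\<close> g weighted_integral_expectation(2) by (intro AE_finite_allI) auto
  then show ?thesis
  proof eventually_elim
    case (elim w)
    have "weighted_integral (\<lambda>s. \<Sum>x\<in>A. c x * g x s) w = (\<integral>s. (\<Sum>x\<in>A. c x * (g x s * X s w)) \<partial>N)"
      by (simp add: weighted_integral_def sum_distrib_right mult.assoc)
    also have "\<dots> = (\<Sum>x\<in>A. c x * weighted_integral (g x) w)"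
      using elim by (subst Bochner_Integration.integral_sum) (auto simp: weighted_integral_def)
    finally show ?case .
  qed
qed

text \<open>The combination is almost surely the integral of one bounded weight; so normality of
  single integrals yields joint normality of several.\<close>

lemma normal_rv_combination_of_integrals:
  assumes "finite A" and g: "\<And>x. x \<in> A \<Longrightarrow> bounded_weight (g x)"
    and V: "\<And>x. x \<in> A \<Longrightarrow> random_variable borel (V x)"
    and eq: "\<And>x. x \<in> A \<Longrightarrow> AE w in M. V x w = weighted_integral (g x) w"
  shows "normal_rv M (\<lambda>w. \<Sum>x\<in>A. c x * V x w)"
proof -
  have weight: "bounded_weight (\<lambda>s. \<Sum>x\<in>A. c x * g x s)"
    using g by (intro bounded_weight_sum bounded_weight_cmult)
  have "AE w in M. \<forall>x\<in>A. V x w = weighted_integral (g x) w"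
    using \<open>finite A\<close> eq by (intro AE_finite_allI) auto
  moreover have "AE w in M. weighted_integral (\<lambda>s. \<Sum>x\<in>A. c x * g x s) w = (\<Sum>x\<in>A. c x * weighted_integral (g x) w)"
    using \<open>finite A\<close> g by (rule weighted_integral_sum)
  ultimately have "AE w in M. (\<Sum>x\<in>A. c x * V x w) = weighted_integral (\<lambda>s. \<Sum>x\<in>A. c x * g x s) w"
    by eventually_elim simp
  moreover have "random_variable borel (\<lambda>w. \<Sum>x\<in>A. c x * V x w)"
    using V by (intro borel_measurable_sum borel_measurable_times) auto
  ultimately show ?thesis
    using weighted_integral_measurable[OF weight] weighted_integral_normal(2)[OF weight]
    by (subst normal_rv_cong_AE) auto
qed

end

section \<open>The pathwise response equation\<close>

lemma set_integrable_mult_bounded: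
  fixes f g :: "'a \<Rightarrow> real"
  assumes f: "set_integrable M A f" and g: "g \<in> borel_measurable M" and [measurable]: "A \<in> sets M"
    and C: "\<And>x. x \<in> A \<Longrightarrow> \<bar>g x\<bar> \<le> C"
  shows "set_integrable M A (\<lambda>x. f x * g x)"
  unfolding set_integrable_def
proof (rule Bochner_Integration.integrable_bound)
  have int: "integrable M (\<lambda>x. indicator A x * f x)"
    using f by (simp add: set_integrable_def)
  then show "integrable M (\<lambda>x. C * (indicator A x * f x))"
    by simp
  have "(\<lambda>x. (indicator A x * f x) * g x) \<in> borel_measurable M"
    using int g by measurable
  then show "(\<lambda>x. indicator A x *\<^sub>R (f x * g x)) \<in> borel_measurable M"
    by (simp add: mult.assoc)
  have "\<bar>indicator A x * (f x * g x)\<bar> \<le> \<bar>C * (indicator A x * f x)\<bar>" for x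
  proof (cases "x \<in> A")
    case True
    then have "\<bar>f x\<bar> * \<bar>g x\<bar> \<le> \<bar>f x\<bar> * \<bar>C\<bar>"
      using C[OF True] by (intro mult_left_mono) auto
    with True show ?thesis
      by (simp add: abs_mult mult.commute)
  qed simp
  then show "AE x in M. norm (indicator A x *\<^sub>R (f x * g x)) \<le> norm (C * (indicator A x * f x))"
    by simp
qed

text \<open>The equation makes only its integrand \<open>u\<close> integrable; \<open>f\<close> and
  \<open>x\<close> need not be measurable separately. On [0, t], \<open>x\<close> is the primitive
  \<open>y\<close> of \<open>u\<close>, which is bounded and measurable, and q f = d u + y.
  Exchanging integrals turns the integral of y e into d x(t) minus d times that of u e; adding d
  times the integral of u e leaves d x(t). No path is differentiated.\<close>

lemma
  assumes "0 < d" and x: "solves_response d q f x" and "0 \<le> t"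
  shows solves_response_imp_integrable: "set_integrable lborel {0..t} (\<lambda>s. q * f s)"
    and solves_response_formula: "x t = q / d * (LBINT s:{0..t}. f s * exp (- (t - s) / d))"
proof -
  define e where "e s = exp (- (t - s) / d)" for s
  define u where "u s = indicator {0..t} s * (1 / d * (q * f s - x s))" for s
  define y where "y s = (\<integral>r. indicator {..s} r * u r \<partial>lborel)" for s
  have [measurable]: "e \<in> borel_measurable borel"
    unfolding e_def by measurable
  have e_le: "\<bar>e s\<bar> \<le> 1" if "s \<le> t" for s
    using that \<open>0 < d\<close> by (simp add: e_def divide_nonpos_pos)
  have u: "integrable lborel u"
  proof -
    have "set_integrable lborel {0..t} (\<lambda>s. 1 / d * (q * f s - x s))"
      using x \<open>0 \<le> t\<close> unfolding solves_response_def by blast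
    then show ?thesis
      unfolding set_integrable_def u_def real_scaleR_def .
  qed
  then have u_meas[measurable]: "u \<in> borel_measurable borel"
    by simp
  have x_eq: "x s = y s" if "s \<in> {0..t}" for s
  proof -
    have "x s = (LBINT r:{0..s}. 1 / d * (q * f r - x r))"
      using x that unfolding solves_response_def by simp
    also have "\<dots> = y s"
      unfolding y_def set_lebesgue_integral_def
      by (intro Bochner_Integration.integral_cong) (use that in \<open>auto simp: u_def indicator_def\<close>)
    finally show ?thesis .
  qed
  have y_meas[measurable]: "y \<in> borel_measurable borel"
  proof -
    have "(\<lambda>s. \<integral>r. (if r \<le> s then u r else 0) \<partial>lborel) \<in> borel_measurable borel"
      by measurable
    also have "(\<lambda>s. \<integral>r. (if r \<le> s then u r else 0) \<partial>lborel) = y"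
      unfolding y_def by (intro ext Bochner_Integration.integral_cong) (auto simp: indicator_def)
    finally show ?thesis .
  qed
  define U where "U = (\<integral>r. \<bar>u r\<bar> \<partial>lborel)"
  have y_le: "\<bar>y s\<bar> \<le> U" for s
  proof -
    have "\<bar>y s\<bar> \<le> (\<integral>r. \<bar>indicator {..s} r * u r\<bar> \<partial>lborel)"
      unfolding y_def by (rule integral_abs_bound)
    also have "\<dots> \<le> U"
      unfolding U_def using u
      by (intro integral_mono integrable_abs Bochner_Integration.integrable_bound[OF u]) (auto simp: indicator_def)
    finally show ?thesis .
  qed
  have one: "set_integrable lborel {0..t} (\<lambda>_. 1 :: real)"
    by (auto simp: set_integrable_def emeasure_lborel_Icc_eq intro!: integrable_real_indicator)
  have ye: "set_integrable lborel {0..t} (\<lambda>s. y s * e s)" "set_integrable lborel {0..t} y"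
    using set_integrable_mult_bounded[OF set_integrable_mult_bounded[OF one, of y U], of e 1]
      set_integrable_mult_bounded[OF one, of y U] y_le e_le by auto
  have u_set: "set_integrable lborel {0..t} u"
  proof -
    have "(\<lambda>s. indicator {0..t} s *\<^sub>R u s) = u"
      by (auto simp: u_def indicator_def)
    then show ?thesis
      using u by (simp add: set_integrable_def)
  qed
  have ue: "set_integrable lborel {0..t} (\<lambda>s. u s * e s)"
    by (rule set_integrable_mult_bounded[OF u_set, of _ 1]) (use e_le in auto)
  have qf: "q * f s = d * u s + y s" if "s \<in> {0..t}" for s
    using x_eq[OF that] that \<open>0 < d\<close> by (simp add: u_def)
  have "set_integrable lborel {0..t} (\<lambda>s. d * u s + y s)"
    using u_set ye by (intro set_integral_add set_integrable_mult_right) auto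
  then show "set_integrable lborel {0..t} (\<lambda>s. q * f s)"
    by (rule set_integrable_cong[THEN iffD1, rotated -1]) (auto simp: qf)
  \<comment> \<open>A primitive of \<open>e\<close> is \<open>d * e\<close>, and \<open>e t\<close>
    is 1.\<close>
  have kernel: "(\<integral>s. indicator {r..t} s * e s \<partial>lborel) = d * (1 - e r)" if "r \<le> t" for r
  proof -
    have "(\<integral>s. e s * indicator {r..t} s \<partial>lborel) = d * e t - d * e r"
    proof (rule integral_FTC_Icc_real[OF that])
      show "((\<lambda>s. d * e s) has_real_derivative e s) (at s)" for s
        unfolding e_def using \<open>0 < d\<close> by (auto intro!: derivative_eq_intros)
      show "isCont e s" for s
        unfolding e_def using \<open>0 < d\<close> by (auto intro!: continuous_intros)
    qed
    then show ?thesis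
      by (simp add: e_def mult.commute algebra_simps)
  qed
  \<comment> \<open>The integrand lives on the triangle 0 <= r <= s <= t, as \<open>u\<close>
    vanishes off [0, t]; it is dominated by |u r| on the strip.\<close>
  have "integrable (lborel \<Otimes>\<^sub>M lborel) (\<lambda>(s, r). indicator {0..t} s * e s * (if r \<le> s then u r else 0))"
  proof (rule lborel_pair.Fubini_integrable)
    have le: "\<bar>indicator {0..t} s * e s * (if r \<le> s then u r else 0)\<bar> \<le> indicator {0..t} s * \<bar>u r\<bar>" for s r
      using e_le[of s] by (auto simp: indicator_def abs_mult mult_left_le_one_le)
    have int: "integrable lborel (\<lambda>r. indicator {0..t} s * e s * (if r \<le> s then u r else 0))" for s
    proof (rule Bochner_Integration.integrable_bound)
      show "integrable lborel (\<lambda>r. indicator {0..t} s * \<bar>u r\<bar>)"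
        using u by simp
    qed (use le in auto)
    then show "AE s in lborel. integrable lborel
        (\<lambda>r. case (s, r) of (s, r) \<Rightarrow> indicator {0..t} s * e s * (if r \<le> s then u r else 0))"
      by simp
    have bound: "(\<integral>r. \<bar>indicator {0..t} s * e s * (if r \<le> s then u r else 0)\<bar> \<partial>lborel) \<le> indicator {0..t} s * U" for s
    proof -
      have "(\<integral>r. \<bar>indicator {0..t} s * e s * (if r \<le> s then u r else 0)\<bar> \<partial>lborel)
          \<le> (\<integral>r. indicator {0..t} s * \<bar>u r\<bar> \<partial>lborel)"
        using u int le by (intro integral_mono) auto
      then show ?thesis
        by (simp add: U_def)
    qed
    show "integrable lborel (\<lambda>s. \<integral>r. norm (case (s, r) of (s, r) \<Rightarrow>
        indicator {0..t} s * e s * (if r \<le> s then u r else 0)) \<partial>lborel)"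
    proof (rule Bochner_Integration.integrable_bound)
      show "integrable lborel (\<lambda>s. indicator {0..t} s * U)"
        using one by (simp add: set_integrable_def)
    qed (use bound in \<open>auto intro: order_trans[OF _ abs_ge_self]\<close>)
  qed measurable
  note fubini = lborel_pair.Fubini_integral[OF this]
  have "(LBINT s:{0..t}. y s * e s) = (\<integral>r. (\<integral>s. indicator {0..t} s * e s * (if r \<le> s then u r else 0) \<partial>lborel) \<partial>lborel)"
  proof -
    have inner: "(\<integral>r. indicator {0..t} s * e s * (if r \<le> s then u r else 0) \<partial>lborel) = indicator {0..t} s *\<^sub>R (y s * e s)" for s
    proof -
      have eq: "indicator {0..t} s * e s * (if r \<le> s then u r else 0) = indicator {0..t} s * e s * (indicator {..s} r * u r)" for r
        by (simp add: indicator_def)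
      show ?thesis
        unfolding eq integral_mult_right_zero y_def[symmetric] by simp
    qed
    show ?thesis
      unfolding set_lebesgue_integral_def fubini by (simp only: inner)
  qed
  also have "\<dots> = (\<integral>r. d * (u r - u r * e r) \<partial>lborel)"
  proof (intro Bochner_Integration.integral_cong refl)
    fix r :: real
    show "(\<integral>s. indicator {0..t} s * e s * (if r \<le> s then u r else 0) \<partial>lborel) = d * (u r - u r * e r)"
    proof (cases "r \<in> {0..t}")
      case True
      then have "(\<integral>s. indicator {0..t} s * e s * (if r \<le> s then u r else 0) \<partial>lborel)
          = (\<integral>s. indicator {r..t} s * e s * u r \<partial>lborel)"
        by (intro Bochner_Integration.integral_cong) (auto simp: indicator_def)
      also have "\<dots> = d * (1 - e r) * u r"
        using kernel[of r] True by simp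
      finally show ?thesis
        by (simp add: algebra_simps)
    next
      case False
      then have "u r = 0"
        by (simp add: u_def)
      then show ?thesis
        by (simp cong: if_cong)
    qed
  qed
  also have "\<dots> = d * ((\<integral>r. u r \<partial>lborel) - (LBINT r:{0..t}. u r * e r))"
  proof -
    have eq: "indicator {0..t} r *\<^sub>R (u r * e r) = u r * e r" for r
      by (simp add: u_def indicator_def)
    show ?thesis
      using u ue by (simp add: set_lebesgue_integral_def set_integrable_def eq del: real_scaleR_def)
  qed
  also have "(\<integral>r. u r \<partial>lborel) = x t"
  proof -
    have "x t = (LBINT r:{0..t}. 1 / d * (q * f r - x r))"
      using x \<open>0 \<le> t\<close> unfolding solves_response_def by simp
    then show ?thesis
      unfolding u_def set_lebesgue_integral_def real_scaleR_def ..
  qed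
  finally have *: "(LBINT s:{0..t}. y s * e s) = d * (x t - (LBINT r:{0..t}. u r * e r))" .
  have "q * (LBINT s:{0..t}. f s * e s) = (LBINT s:{0..t}. d * (u s * e s) + y s * e s)"
  proof -
    have "q * (LBINT s:{0..t}. f s * e s) = (LBINT s:{0..t}. q * (f s * e s))"
      by simp
    also have "\<dots> = (LBINT s:{0..t}. d * (u s * e s) + y s * e s)"
    proof (rule set_lebesgue_integral_cong)
      have "q * (f s * e s) = d * (u s * e s) + y s * e s" if "s \<in> {0..t}" for s
        using arg_cong[OF qf[OF that], of "\<lambda>z. z * e s"] by (simp add: algebra_simps)
      then show "\<forall>s. s \<in> {0..t} \<longrightarrow> q * (f s * e s) = d * (u s * e s) + y s * e s"
        by blast
    qed simp
    finally show ?thesis .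
  qed
  also have "\<dots> = d * (LBINT s:{0..t}. u s * e s) + (LBINT s:{0..t}. y s * e s)"
    using ue ye by (subst set_integral_add) auto
  \<comment> \<open>The two multiples of the integral of u e cancel.\<close>
  also have "\<dots> = d * x t"
    using * by (simp add: algebra_simps)
  finally show "x t = q / d * (LBINT s:{0..t}. f s * exp (- (t - s) / d))"
    using \<open>0 < d\<close> by (simp add: e_def field_simps)
qed

section \<open>Responses to a Gaussian process\<close>

lemma gaussian_process_moments:
  assumes "gaussian_process M X m c" "0 \<le> s" "0 \<le> t"
  shows "(\<integral>w. X s w \<partial>M) = m s" and "covariance M (X s) (X t) = c s t"
proof -
  have "multivariate_normal M 2 (\<lambda>a. X (if a = 0 then s else t)) (\<lambda>a. m (if a = 0 then s else t))
      (\<lambda>a b. c (if a = 0 then s else t) (if b = 0 then s else t))"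
    using assms(1)[unfolded gaussian_process_def, rule_format, of 2 "\<lambda>a. if a = 0 then s else t"] assms(2,3)
    by simp
  then have "\<forall>a<(2::nat). (\<integral>w. X (if a = 0 then s else t) w \<partial>M) = m (if a = 0 then s else t)"
    and "\<forall>a<(2::nat). \<forall>b<(2::nat). covariance M (X (if a = 0 then s else t)) (X (if b = 0 then s else t))
      = c (if a = 0 then s else t) (if b = 0 then s else t)"
    unfolding multivariate_normal_def by blast+
  from this(1)[rule_format, of 0] this(2)[rule_format, of 0 "Suc 0"]
  show "(\<integral>w. X s w \<partial>M) = m s" and "covariance M (X s) (X t) = c s t"
    by simp_all
qed

lemma gaussian_field_of_process:
  assumes "prob_space M" and gp: "gaussian_process M F mF K"
    and meas: "(\<lambda>(t, w). F t w) \<in> borel_measurable (restrict_space borel {0..} \<Otimes>\<^sub>M M)"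
    and paths: "AE w in M. set_integrable lborel {0..T} (\<lambda>s. F s w)"
  shows "gaussian_field M (restrict_space lborel {0..T}) F"
proof -
  interpret prob_space M by fact
  show ?thesis
  proof (intro gaussian_field.intro gaussian_field_axioms.intro finite_measureI)
    show "prob_space M" by fact
    show "emeasure (restrict_space lborel {0..T}) (space (restrict_space lborel {0..T})) \<noteq> \<infinity>"
      by (simp add: emeasure_restrict_space space_restrict_space emeasure_lborel_Icc_eq)
    \<comment> \<open>\<open>F\<close> is measurable at nonnegative times only, so the shorter
      interval is embedded in the half-line.\<close>
    have "(\<lambda>s. s) \<in> restrict_space lborel {0..T} \<rightarrow>\<^sub>M restrict_space borel {0..}"
      by (intro measurable_restrict_space3) auto
    then have "(\<lambda>p. (fst p, snd p)) \<in> restrict_space lborel {0..T} \<Otimes>\<^sub>M M \<rightarrow>\<^sub>M restrict_space borel {0..} \<Otimes>\<^sub>M M"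
      by measurable
    from measurable_compose[OF this meas]
    show "case_prod F \<in> borel_measurable (restrict_space lborel {0..T} \<Otimes>\<^sub>M M)"
      by (simp add: case_prod_unfold)
    show "normal_rv M (\<lambda>w. \<Sum>i<n. c i * F (s i) w)"
      if "\<And>i. i < n \<Longrightarrow> s i \<in> space (restrict_space lborel {0..T})"
      for n :: nat and s :: "nat \<Rightarrow> real" and c :: "nat \<Rightarrow> real"
      using gp[unfolded gaussian_process_def, rule_format, of n s] that
      by (auto simp: multivariate_normal_def space_restrict_space)
    show "AE w in M. integrable (restrict_space lborel {0..T}) (\<lambda>s. F s w)"
      using paths by (simp add: integrable_restrict_space set_integrable_def)
  qed
qed

text \<open>Up to the factor q / d, the Green function of the response equation. The cut-off at
  \<open>t\<close> turns integrals over [0, t] into integrals over any longer interval, so that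
  several times share one measure space.\<close>

definition response_kernel :: "real \<Rightarrow> real \<Rightarrow> real \<Rightarrow> real" where
  "response_kernel d t s = indicator {0..t} s * exp (- (t - s) / d)"

lemma response_kernel_bounded:
  assumes "0 < d"
  shows "\<bar>response_kernel d t s\<bar> \<le> 1"
  using assms by (simp add: response_kernel_def indicator_def divide_nonpos_pos)

lemma response_kernel_measurable[measurable]: "response_kernel d t \<in> borel_measurable borel"
  unfolding response_kernel_def by measurable

lemma
  fixes f :: "real \<Rightarrow> real"
  assumes "t \<le> T"
  shows set_integrable_response_kernel:
      "set_integrable lborel {0..t} (\<lambda>s. f s * exp (- (t - s) / d)) \<longleftrightarrow>
        integrable (restrict_space lborel {0..T}) (\<lambda>s. response_kernel d t s * f s)"
    and set_integral_response_kernel: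
      "(LBINT s:{0..t}. f s * exp (- (t - s) / d)) =
        (\<integral>s. response_kernel d t s * f s \<partial>restrict_space lborel {0..T})"
proof -
  have "indicator {0..t} s *\<^sub>R (f s * exp (- (t - s) / d)) = indicator {0..T} s *\<^sub>R (response_kernel d t s * f s)" for s
    using assms by (auto simp: response_kernel_def indicator_def)
  then show "set_integrable lborel {0..t} (\<lambda>s. f s * exp (- (t - s) / d)) \<longleftrightarrow>
        integrable (restrict_space lborel {0..T}) (\<lambda>s. response_kernel d t s * f s)"
    and "(LBINT s:{0..t}. f s * exp (- (t - s) / d)) =
        (\<integral>s. response_kernel d t s * f s \<partial>restrict_space lborel {0..T})"
    by (simp_all add: set_integrable_def set_lebesgue_integral_def integrable_restrict_space
        integral_restrict_space del: real_scaleR_def)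
qed

text \<open>The solution formula and integrable paths of \<open>F\<close> replace the response
  equation. In this form the model can also be instantiated with the zero process as forcing, as is
  done when all \<open>q i\<close> vanish.\<close>

locale response_model = prob_space M
  for M :: "'w measure" and F :: "real \<Rightarrow> 'w \<Rightarrow> real" and mF :: "real \<Rightarrow> real" and K :: "real \<Rightarrow> real \<Rightarrow> real"
    and I :: "'i set" and d q :: "'i \<Rightarrow> real" and S :: "'i \<Rightarrow> real \<Rightarrow> 'w \<Rightarrow> real" +
  assumes finite_I: "finite I"
    and d_pos: "i \<in> I \<Longrightarrow> 0 < d i"
    and gaussian: "gaussian_process M F mF K"
    and F_measurable: "(\<lambda>(t, w). F t w) \<in> borel_measurable (restrict_space borel {0..} \<Otimes>\<^sub>M M)"
    and F_paths: "AE w in M. \<forall>t\<ge>0. set_integrable lborel {0..t} (\<lambda>s. F s w)"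
    and S_measurable: "i \<in> I \<Longrightarrow> 0 \<le> t \<Longrightarrow> S i t \<in> borel_measurable M"
    and S_eq: "i \<in> I \<Longrightarrow> AE w in M. \<forall>t\<ge>0.
      S i t w = q i / d i * (LBINT s:{0..t}. F s w * exp (- (t - s) / d i))"
begin

lemma field: "gaussian_field M (restrict_space lborel {0..T}) F"
proof (cases "0 \<le> T")
  case True
  show ?thesis
    by (rule gaussian_field_of_process[OF prob_space_axioms gaussian F_measurable])
       (use F_paths True in \<open>auto elim: eventually_mono\<close>)
next
  \<comment> \<open>For negative \<open>T\<close> the interval is empty; admitting it spares
    \<open>field\<close> a side condition.\<close>
  case False
  then show ?thesis
    by (intro gaussian_field_of_process[OF prob_space_axioms gaussian F_measurable])
       (simp add: set_integrable_def)
qed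

lemma bounded_weight_kernel:
  assumes "i \<in> I"
  shows "gaussian_field.bounded_weight (restrict_space lborel {0..T}) (response_kernel (d i) t)"
proof -
  interpret gaussian_field M "restrict_space lborel {0..T}" F by (rule field)
  show ?thesis
    using response_kernel_bounded[OF d_pos[OF assms]]
    by (auto simp: bounded_weight_def intro!: measurable_restrict_space1 exI[of _ 1])
qed

lemma S_eq_weighted_integral:
  assumes "i \<in> I" "0 \<le> t" "t \<le> T"
  shows "AE w in M. S i t w =
    q i / d i * gaussian_field.weighted_integral (restrict_space lborel {0..T}) F (response_kernel (d i) t) w"
proof -
  interpret gaussian_field M "restrict_space lborel {0..T}" F by (rule field)
  from S_eq[OF \<open>i \<in> I\<close>] show ?thesis
    unfolding weighted_integral_def set_integral_response_kernel[OF \<open>t \<le> T\<close>, symmetric]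
    by (rule eventually_mono) (use \<open>0 \<le> t\<close> in blast)
qed

lemma kernel_integrable_path:
  assumes "i \<in> I"
  shows "AE w in M. \<forall>t\<ge>0. set_integrable lborel {0..t} (\<lambda>s. F s w * exp (- (t - s) / d i))"
  using F_paths
proof eventually_elim
  case (elim w)
  show ?case
  proof safe
    fix t :: real assume "0 \<le> t"
    with elim have "set_integrable lborel {0..t} (\<lambda>s. F s w)"
      by blast
    then show "set_integrable lborel {0..t} (\<lambda>s. F s w * exp (- (t - s) / d i))"
      by (rule set_integrable_mult_bounded[where C = 1]) (use d_pos[OF assms] in \<open>auto simp: divide_nonpos_pos\<close>)
  qed
qed

lemma kernel_integrable_mean:
  assumes "i \<in> I" "0 \<le> t"
  shows "set_integrable lborel {0..t} (\<lambda>s. mF s * exp (- (t - s) / d i))"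
proof -
  interpret gaussian_field M "restrict_space lborel {0..t}" F by (rule field)
  show ?thesis
    unfolding set_integrable_response_kernel[OF order_refl]
    using weighted_integral_expectation(1)[OF bounded_weight_kernel[OF \<open>i \<in> I\<close>], of t]
    by (rule Bochner_Integration.integrable_cong[THEN iffD1, rotated -1])
       (auto simp: gaussian_process_moments[OF gaussian] space_restrict_space)
qed

text \<open>The factor in \<open>\<delta>\<close> is constant in \<open>s'\<close>; moved outside,
  it becomes the weight of the outer integral. \<open>K\<close> agrees with the covariances because
  only nonnegative times occur.\<close>

lemma inner_covariance_integral:
  assumes "0 \<le> s" "t' \<le> T"
  shows "(LBINT s':{0..t'}. K s s' * exp (- (t - s) / \<delta>) * exp (- (t' - s') / d j)) =
    (\<integral>s'. response_kernel (d j) t' s' * covariance M (F s) (F s') \<partial>restrict_space lborel {0..T}) * exp (- (t - s) / \<delta>)"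
proof -
  have "(LBINT s':{0..t'}. K s s' * exp (- (t - s) / \<delta>) * exp (- (t' - s') / d j)) =
      (\<integral>s'. response_kernel (d j) t' s' * (K s s' * exp (- (t - s) / \<delta>)) \<partial>restrict_space lborel {0..T})"
    by (rule set_integral_response_kernel[OF \<open>t' \<le> T\<close>])
  also have "\<dots> = (\<integral>s'. response_kernel (d j) t' s' * covariance M (F s) (F s') * exp (- (t - s) / \<delta>) \<partial>restrict_space lborel {0..T})"
    using assms by (intro Bochner_Integration.integral_cong)
      (auto simp: gaussian_process_moments[OF gaussian] space_restrict_space)
  finally show ?thesis
    by simp
qed

lemma kernel_integrable_covariance:
  assumes "i \<in> I" "j \<in> I" "0 \<le> t" "0 \<le> t'"
  shows "s \<in> {0..t} \<Longrightarrow> set_integrable lborel {0..t'} (\<lambda>s'. K s s' * exp (- (t - s) / d i) * exp (- (t' - s') / d j))"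
    and "set_integrable lborel {0..t} (\<lambda>s. LBINT s':{0..t'}. K s s' * exp (- (t - s) / d i) * exp (- (t' - s') / d j))"
proof -
  \<comment> \<open>A common horizon: neither time is negative, so the sum bounds both.\<close>
  define T where "T = t + t'"
  have T: "t \<le> T" "t' \<le> T"
    using assms by (auto simp: T_def)
  interpret gaussian_field M "restrict_space lborel {0..T}" F by (rule field)
  note int = weighted_integrals_covariance(1,2)[OF bounded_weight_kernel[OF \<open>i \<in> I\<close>] bounded_weight_kernel[OF \<open>j \<in> I\<close>]]
  show "set_integrable lborel {0..t'} (\<lambda>s'. K s s' * exp (- (t - s) / d i) * exp (- (t' - s') / d j))"
    if "s \<in> {0..t}"
  proof -
    have "integrable (restrict_space lborel {0..T})
        (\<lambda>s'. response_kernel (d j) t' s' * covariance M (F s) (F s') * exp (- (t - s) / d i))"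
      using int(1)[of s t'] that T by (simp add: space_restrict_space)
    then show ?thesis
      unfolding set_integrable_response_kernel[OF \<open>t' \<le> T\<close>]
      by (rule Bochner_Integration.integrable_cong[THEN iffD1, rotated -1])
         (use that in \<open>auto simp: gaussian_process_moments[OF gaussian] space_restrict_space\<close>)
  qed
  have int_outer: "set_integrable lborel {0..t} (\<lambda>s.
      (\<integral>s'. response_kernel (d j) t' s' * covariance M (F s) (F s') \<partial>restrict_space lborel {0..T}) * exp (- (t - s) / d i))"
    unfolding set_integrable_response_kernel[OF \<open>t \<le> T\<close>] by (rule int(2))
  have eq: "(LBINT s':{0..t'}. K s s' * exp (- (t - s) / d i) * exp (- (t' - s') / d j)) =
      (\<integral>s'. response_kernel (d j) t' s' * covariance M (F s) (F s') \<partial>restrict_space lborel {0..T}) * exp (- (t - s) / d i)"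
    if "s \<in> {0..t}" for s
    using that by (intro inner_covariance_integral T) simp
  show "set_integrable lborel {0..t} (\<lambda>s. LBINT s':{0..t'}. K s s' * exp (- (t - s) / d i) * exp (- (t' - s') / d j))"
    by (rule iffD2[OF set_integrable_cong[OF refl refl eq] int_outer])
qed

text \<open>Component and time both vary with the index. This covers one response at several times
  as well as the total response, with pairs of a time index and a component as indices.\<close>

lemma S_combination_normal:
  fixes t :: "'x \<Rightarrow> real"
  assumes "finite A" "\<And>x. x \<in> A \<Longrightarrow> \<iota> x \<in> I" "\<And>x. x \<in> A \<Longrightarrow> 0 \<le> t x"
  shows "normal_rv M (\<lambda>w. \<Sum>x\<in>A. c x * S (\<iota> x) (t x) w)"
proof -
  \<comment> \<open>The sum of nonnegative times bounds each of them and, unlike a maximum, makes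
    sense for empty \<open>A\<close>.\<close>
  define T where "T = (\<Sum>x\<in>A. t x)"
  have T: "t x \<le> T" if "x \<in> A" for x
    using assms that unfolding T_def by (intro member_le_sum) auto
  interpret gaussian_field M "restrict_space lborel {0..T}" F by (rule field)
  have "bounded_weight (\<lambda>s. q (\<iota> x) / d (\<iota> x) * response_kernel (d (\<iota> x)) (t x) s)" if "x \<in> A" for x
    using assms that by (intro bounded_weight_cmult bounded_weight_kernel) auto
  moreover have "AE w in M. S (\<iota> x) (t x) w =
      weighted_integral (\<lambda>s. q (\<iota> x) / d (\<iota> x) * response_kernel (d (\<iota> x)) (t x) s) w" if "x \<in> A" for x
    using S_eq_weighted_integral[OF assms(2,3) T, OF that that that]
    by (simp add: weighted_integral_def mult.assoc)
  ultimately show ?thesis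
    using assms S_measurable by (intro normal_rv_combination_of_integrals) auto
qed

lemma S_square_integrable:
  assumes "i \<in> I" "0 \<le> t"
  shows "integrable M (\<lambda>w. (S i t w)\<^sup>2)"
proof -
  have "normal_rv M (S i t)"
    using S_combination_normal[of "{()}" "\<lambda>_. i" "\<lambda>_. t" "\<lambda>_. 1"] assms by simp
  then show ?thesis
    by (rule normal_rv_moments(1))
qed

lemma S_expectation:
  assumes "i \<in> I" "0 \<le> t"
  shows "expectation (S i t) = response_mean (d i) (q i) mF t"
proof -
  interpret gaussian_field M "restrict_space lborel {0..t}" F by (rule field)
  note weight = bounded_weight_kernel[OF \<open>i \<in> I\<close>, of t t]
  have "expectation (S i t) = expectation (\<lambda>w. q i / d i * weighted_integral (response_kernel (d i) t) w)"
    using S_eq_weighted_integral[OF assms order_refl] S_measurable[OF assms] weighted_integral_measurable[OF weight]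
    by (intro integral_cong_AE) auto
  also have "\<dots> = q i / d i * (\<integral>s. response_kernel (d i) t s * expectation (F s) \<partial>restrict_space lborel {0..t})"
    by (simp add: weighted_integral_expectation(3)[OF weight])
  also have "(\<integral>s. response_kernel (d i) t s * expectation (F s) \<partial>restrict_space lborel {0..t})
      = (\<integral>s. response_kernel (d i) t s * mF s \<partial>restrict_space lborel {0..t})"
    by (intro Bochner_Integration.integral_cong) (auto simp: gaussian_process_moments[OF gaussian] space_restrict_space)
  finally show ?thesis
    unfolding response_mean_def set_integral_response_kernel[OF order_refl] .
qed

lemma S_covariance:
  assumes "i \<in> I" "j \<in> I" "0 \<le> t" "0 \<le> t'"
  shows "covariance M (S i t) (S j t') = response_cov (d i) (q i) (d j) (q j) K t t'"
proof -
  define T where "T = t + t'"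
  have T: "t \<le> T" "t' \<le> T"
    using assms by (auto simp: T_def)
  interpret gaussian_field M "restrict_space lborel {0..T}" F by (rule field)
  note weights = bounded_weight_kernel[OF \<open>i \<in> I\<close>, of T t] bounded_weight_kernel[OF \<open>j \<in> I\<close>, of T t']
  have "covariance M (S i t) (S j t') =
      covariance M (\<lambda>w. q i / d i * weighted_integral (response_kernel (d i) t) w)
        (\<lambda>w. q j / d j * weighted_integral (response_kernel (d j) t') w)"
    using assms T weighted_integral_measurable[OF weights(1)] weighted_integral_measurable[OF weights(2)]
    by (intro covariance_cong_AE S_measurable S_eq_weighted_integral borel_measurable_times borel_measurable_const)
  also have "\<dots> = (q i * q j) / (d i * d j) *
      covariance M (weighted_integral (response_kernel (d i) t)) (weighted_integral (response_kernel (d j) t'))"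
  proof -
    have eq: "(a * x - a * y) * (b * z - b * v) = a * b * ((x - y) * (z - v))" for a b x y z v :: real
      by (simp add: algebra_simps)
    show ?thesis
      unfolding covariance_def integral_mult_right_zero eq by simp
  qed
  also have "covariance M (weighted_integral (response_kernel (d i) t)) (weighted_integral (response_kernel (d j) t')) =
      (LBINT s:{0..t}. LBINT s':{0..t'}. K s s' * exp (- (t - s) / d i) * exp (- (t' - s') / d j))"
  proof -
    have "(LBINT s:{0..t}. LBINT s':{0..t'}. K s s' * exp (- (t - s) / d i) * exp (- (t' - s') / d j)) =
        (LBINT s:{0..t}. (\<integral>s'. response_kernel (d j) t' s' * covariance M (F s) (F s') \<partial>restrict_space lborel {0..T})
          * exp (- (t - s) / d i))"
      by (intro set_lebesgue_integral_cong allI impI inner_covariance_integral T) auto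
    then show ?thesis
      unfolding set_integral_response_kernel[OF T(1)] using weighted_integrals_covariance(3)[OF weights] by simp
  qed
  finally show ?thesis
    by (simp add: response_cov_def)
qed

lemma S_gaussian_process:
  assumes "i \<in> I"
  shows "gaussian_process M (S i) (response_mean (d i) (q i) mF) (response_cov (d i) (q i) (d i) (q i) K)"
  unfolding gaussian_process_def multivariate_normal_def
proof (intro allI impI conjI)
  fix n :: nat and t c :: "nat \<Rightarrow> real"
  assume "\<forall>a<n. 0 \<le> t a"
  then show "normal_rv M (\<lambda>w. \<Sum>a<n. c a * S i (t a) w)"
    using assms by (intro S_combination_normal) auto
qed (simp_all add: assms S_expectation S_covariance)

lemma sum_S_gaussian_process:
  "gaussian_process M (\<lambda>t w. \<Sum>i\<in>I. S i t w) (\<lambda>t. \<Sum>i\<in>I. response_mean (d i) (q i) mF t)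
    (\<lambda>t t'. \<Sum>i\<in>I. \<Sum>j\<in>I. response_cov (d i) (q i) (d j) (q j) K t t')"
  unfolding gaussian_process_def multivariate_normal_def
proof (intro allI impI conjI)
  fix n :: nat and t :: "nat \<Rightarrow> real"
  assume t: "\<forall>a<n. 0 \<le> t a"
  show "normal_rv M (\<lambda>w. \<Sum>a<n. c a * (\<Sum>i\<in>I. S i (t a) w))" for c
    \<comment> \<open>The double sum is read as one sum over pairs, with coefficients that depend on
      the time index alone.\<close>
    using S_combination_normal[of "{..<n} \<times> I" snd "\<lambda>x. t (fst x)" "\<lambda>x. c (fst x)"] t finite_I
    by (auto simp: sum_distrib_left sum.cartesian_product case_prod_unfold)
  fix a assume "a < n"
  with t have a: "0 \<le> t a"
    by blast
  have "integrable M (S i (t a))" if "i \<in> I" for i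
    using square_integrable_imp_integrable[OF S_measurable S_square_integrable] that a by blast
  then show "expectation (\<lambda>w. \<Sum>i\<in>I. S i (t a) w) = (\<Sum>i\<in>I. response_mean (d i) (q i) mF (t a))"
    using a by (simp add: S_expectation)
  fix b assume "b < n"
  with t have b: "0 \<le> t b"
    by blast
  show "covariance M (\<lambda>w. \<Sum>i\<in>I. S i (t a) w) (\<lambda>w. \<Sum>i\<in>I. S i (t b) w) =
      (\<Sum>i\<in>I. \<Sum>j\<in>I. response_cov (d i) (q i) (d j) (q j) K (t a) (t b))"
    using a b by (simp add: covariance_sum S_measurable S_square_integrable S_covariance)
qed

end

text \<open>Serves to pass from the sum of the responses to \<open>T\<close>, which is prescribed at
  nonnegative times only.\<close>

lemma gaussian_process_cong:
  assumes "\<And>t. 0 \<le> t \<Longrightarrow> X t = Y t"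
  shows "gaussian_process M X m c \<longleftrightarrow> gaussian_process M Y m c"
proof -
  have "multivariate_normal M n (\<lambda>a. X (t a)) \<mu> \<Sigma> \<longleftrightarrow> multivariate_normal M n (\<lambda>a. Y (t a)) \<mu> \<Sigma>"
    if "\<forall>a<n. 0 \<le> t a" for n t \<mu> \<Sigma>
    using that assms by (simp add: multivariate_normal_def)
  then show ?thesis
    by (simp add: gaussian_process_def)
qed

text \<open>The substitute for \<open>F\<close> when all coefficients vanish; the constant 0 is
  normal by the degenerate case.\<close>

lemma gaussian_process_zero:
  "gaussian_process M (\<lambda>_ _. 0) (\<lambda>_. 0) (\<lambda>_ _. 0)"
proof -
  have "normal_rv M (\<lambda>_. 0)"
    unfolding normal_rv_def by auto
  then show ?thesis
    by (simp add: gaussian_process_def multivariate_normal_def covariance_def)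
qed

theorem mainTheorem1:
  fixes M :: "'w measure"
    and k :: nat
    and d q :: "nat \<Rightarrow> real"
    and F :: "real \<Rightarrow> 'w \<Rightarrow> real"
    and mF :: "real \<Rightarrow> real"
    and K :: "real \<Rightarrow> real \<Rightarrow> real"
    and S :: "nat \<Rightarrow> real \<Rightarrow> 'w \<Rightarrow> real"
    and T :: "real \<Rightarrow> 'w \<Rightarrow> real"
  assumes "prob_space M"
    and "1 \<le> k"
    and "\<And>i. i \<in> {1..k} \<Longrightarrow> 0 < d i"
    and "gaussian_process M F mF K"
    and "(\<lambda>(t, w). F t w) \<in> borel_measurable (restrict_space borel {0..} \<Otimes>\<^sub>M M)"
    and "\<And>i t. i \<in> {1..k} \<Longrightarrow> 0 \<le> t \<Longrightarrow> S i t \<in> borel_measurable M"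
    and "\<And>i. i \<in> {1..k} \<Longrightarrow> AE w in M. solves_response (d i) (q i) (\<lambda>t. F t w) (\<lambda>t. S i t w)"
    and "\<And>t w. 0 \<le> t \<Longrightarrow> T t w = (\<Sum>i=1..k. S i t w)"
  shows
    (* The first conjunct says that the integrals in the others exist; if all the q i vanish,
       all of these have coefficient 0. *)
    "((\<exists>i\<in>{1..k}. q i \<noteq> 0) \<longrightarrow>
        (\<forall>i\<in>{1..k}. AE w in M. \<forall>t\<ge>0.
           set_integrable lborel {0..t} (\<lambda>s. F s w * exp (- (t - s) / d i))) \<and>
        (\<forall>i\<in>{1..k}. \<forall>t\<ge>0. set_integrable lborel {0..t} (\<lambda>s. mF s * exp (- (t - s) / d i))) \<and>
        (\<forall>i\<in>{1..k}. \<forall>j\<in>{1..k}. \<forall>t\<ge>0. \<forall>t'\<ge>0.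
           (\<forall>s\<in>{0..t}. set_integrable lborel {0..t'}
              (\<lambda>s'. K s s' * exp (- (t - s) / d i) * exp (- (t' - s') / d j))) \<and>
           set_integrable lborel {0..t}
              (\<lambda>s. LBINT s':{0..t'}. K s s' * exp (- (t - s) / d i) * exp (- (t' - s') / d j)))) \<and>
     (\<forall>i\<in>{1..k}. AE w in M. \<forall>t\<ge>0.
            S i t w = q i / d i * (LBINT s:{0..t}. F s w * exp (- (t - s) / d i))) \<and>
     (\<forall>i\<in>{1..k}. gaussian_process M (S i)
            (response_mean (d i) (q i) mF) (response_cov (d i) (q i) (d i) (q i) K)) \<and>
     (\<forall>i\<in>{1..k}. \<forall>j\<in>{1..k}. \<forall>t\<ge>0. \<forall>t'\<ge>0.
            covariance M (S i t) (S j t') = response_cov (d i) (q i) (d j) (q j) K t t') \<and>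
     (gaussian_process M T
            (\<lambda>t. \<Sum>i=1..k. response_mean (d i) (q i) mF t)
            (\<lambda>t t'. \<Sum>i=1..k. \<Sum>j=1..k. response_cov (d i) (q i) (d j) (q j) K t t'))"
proof -
  interpret prob_space M by fact
  have formula: "AE w in M. \<forall>t\<ge>0. S i t w = q i / d i * (LBINT s:{0..t}. F s w * exp (- (t - s) / d i))"
    if i: "i \<in> {1..k}" for i
    using assms(7)[OF i]
  proof (rule eventually_mono)
    fix w assume w: "solves_response (d i) (q i) (\<lambda>t. F t w) (\<lambda>t. S i t w)"
    show "\<forall>t\<ge>0. S i t w = q i / d i * (LBINT s:{0..t}. F s w * exp (- (t - s) / d i))"
      using solves_response_formula[OF assms(3)[OF i] w] by blast
  qed
  let ?processes = "(\<forall>i\<in>{1..k}. gaussian_process M (S i)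
        (response_mean (d i) (q i) mF) (response_cov (d i) (q i) (d i) (q i) K)) \<and>
     (\<forall>i\<in>{1..k}. \<forall>j\<in>{1..k}. \<forall>t\<ge>0. \<forall>t'\<ge>0.
        covariance M (S i t) (S j t') = response_cov (d i) (q i) (d j) (q j) K t t') \<and>
     gaussian_process M (\<lambda>t w. \<Sum>i=1..k. S i t w)
        (\<lambda>t. \<Sum>i=1..k. response_mean (d i) (q i) mF t)
        (\<lambda>t t'. \<Sum>i=1..k. \<Sum>j=1..k. response_cov (d i) (q i) (d j) (q j) K t t')"
  let ?integrals = "(\<forall>i\<in>{1..k}. AE w in M. \<forall>t\<ge>0.
           set_integrable lborel {0..t} (\<lambda>s. F s w * exp (- (t - s) / d i))) \<and>
        (\<forall>i\<in>{1..k}. \<forall>t\<ge>0. set_integrable lborel {0..t} (\<lambda>s. mF s * exp (- (t - s) / d i))) \<and>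
        (\<forall>i\<in>{1..k}. \<forall>j\<in>{1..k}. \<forall>t\<ge>0. \<forall>t'\<ge>0.
           (\<forall>s\<in>{0..t}. set_integrable lborel {0..t'}
              (\<lambda>s'. K s s' * exp (- (t - s) / d i) * exp (- (t' - s') / d j))) \<and>
           set_integrable lborel {0..t}
              (\<lambda>s. LBINT s':{0..t'}. K s s' * exp (- (t - s) / d i) * exp (- (t' - s') / d j)))"
  have "((\<exists>i\<in>{1..k}. q i \<noteq> 0) \<longrightarrow> ?integrals) \<and> ?processes"
  proof (cases "\<exists>i\<in>{1..k}. q i \<noteq> 0")
    case True
    then obtain i where i: "i \<in> {1..k}" and "q i \<noteq> 0"
      by blast
    \<comment> \<open>A single nonzero coefficient gives integrable paths of \<open>F\<close>, and
      these serve all components.\<close>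
    have paths: "AE w in M. \<forall>t\<ge>0. set_integrable lborel {0..t} (\<lambda>s. F s w)"
      using assms(7)[OF i]
    proof (rule eventually_mono)
      fix w assume w: "solves_response (d i) (q i) (\<lambda>t. F t w) (\<lambda>t. S i t w)"
      show "\<forall>t\<ge>0. set_integrable lborel {0..t} (\<lambda>s. F s w)"
        using solves_response_imp_integrable[OF assms(3)[OF i] w] \<open>q i \<noteq> 0\<close>
        by (simp add: set_integrable_mult_right_iff)
    qed
    interpret response_model M F mF K "{1..k}" d q S
      by unfold_locales (use assms paths formula in auto)
    show ?thesis
      by (intro conjI impI ballI allI kernel_integrable_path kernel_integrable_mean kernel_integrable_covariance
          S_gaussian_process S_covariance sum_S_gaussian_process)
  next
    case False
    then have q: "q i = 0" if "i \<in> {1..k}" for i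
      using that by blast
    \<comment> \<open>The paths of \<open>F\<close> need not be integrable, but the responses do not depend on \<open>F\<close>.\<close>
    interpret response_model M "\<lambda>_ _. 0" "\<lambda>_. 0" "\<lambda>_ _. 0" "{1..k}" d q S
      by unfold_locales (use assms formula q gaussian_process_zero in \<open>auto simp: set_integrable_def\<close>)
    \<comment> \<open>Mean and covariance carry the factor \<open>q i\<close>, which is 0, so
      \<open>mF\<close> and \<open>K\<close> can be put back.\<close>
    have "response_mean (d i) (q i) (\<lambda>_. 0) = response_mean (d i) (q i) mF" if "i \<in> {1..k}" for i
      by (simp add: response_mean_def fun_eq_iff q[OF that])
    moreover have "response_cov (d i) (q i) (d j) (q j) (\<lambda>_ _. 0) = response_cov (d i) (q i) (d j) (q j) K"
      if "i \<in> {1..k}" for i j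
      by (simp add: response_cov_def fun_eq_iff q[OF that])
    ultimately have ?processes
      using S_gaussian_process S_covariance sum_S_gaussian_process by simp
    with False show ?thesis
      by blast
  qed
  moreover have "gaussian_process M T m c \<longleftrightarrow> gaussian_process M (\<lambda>t w. \<Sum>i=1..k. S i t w) m c" for m c
    by (rule gaussian_process_cong) (use assms(8) in auto)
  ultimately show ?thesis
    using formula by blast
qed

end
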